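(* For a Banach lattice $E$, the following are equivalent: (1) every almost Grothendieck subset of $E$ is relatively weakly compact; (2) for every Banach space $X$, every almost Grothendieck operator $T: X \to E$ is weakly compact; (3) every almost Grothendieck operator $T: \ell_1 \to E$ is weakly compact.
   Context: Every bounded linear operator $S: E \to c_0$ has the form $S(x) = (x_n'(x))_n$ for a unique weak* null sequence $(x_n') \subset E'$; $S$ is a disjoint operator if $(x_n')$ is disjoint in the dual Banach lattice $E'$. A subset $A \subset E$ is almost Grothendieck if $S(A)$ is relatively weakly compact in $c_0$ for every disjoint operator $S: E \to c_0$. A bounded operator $T: X \to E$ from a Banach space $X$ is almost Grothendieck if $T'y_n' \to 0$ weakly in $X'$ for every disjoint weak* null sequence $(y_n') \subset E'$. *)

theory Defs
  imports "HOL-Analysis.Analysis"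
begin

class banach_lattice = banach + ordered_real_vector + lattice +
  assumes lattice_norm: "sup x (- x) \<le> sup y (- y) \<Longrightarrow> norm x \<le> norm y"

definition lmod :: "'a::banach_lattice \<Rightarrow> 'a" where
  "lmod x = sup x (- x)"

section \<open>Lattice operations in the dual E' (Riesz--Kantorovich formulas)\<close>

definition dual_mod :: "('a::banach_lattice \<Rightarrow>\<^sub>L real) \<Rightarrow> 'a \<Rightarrow> real" where
  "dual_mod f x = (SUP y\<in>{y. lmod y \<le> x}. \<bar>blinfun_apply f y\<bar>)"

text \<open>f and g are disjoint in E' iff |f| \<and> |g| = 0, where for x \<ge> 0
  (|f| \<and> |g|)(x) = inf { |f|(y) + |g|(x - y) : 0 \<le> y \<le> x }.\<close>
definition dual_disjoint :: "('a::banach_lattice \<Rightarrow>\<^sub>L real) \<Rightarrow> ('a \<Rightarrow>\<^sub>L real) \<Rightarrow> bool" where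
  "dual_disjoint f g \<longleftrightarrow>
     (\<forall>x. 0 \<le> x \<longrightarrow> (INF y\<in>{y. 0 \<le> y \<and> y \<le> x}. dual_mod f y + dual_mod g (x - y)) = 0)"

definition disjoint_seq :: "(nat \<Rightarrow> ('a::banach_lattice \<Rightarrow>\<^sub>L real)) \<Rightarrow> bool" where
  "disjoint_seq f \<longleftrightarrow> (\<forall>n m. n \<noteq> m \<longrightarrow> dual_disjoint (f n) (f m))"

definition weak_star_null :: "(nat \<Rightarrow> ('a::real_normed_vector \<Rightarrow>\<^sub>L real)) \<Rightarrow> bool" where
  "weak_star_null f \<longleftrightarrow> (\<forall>x. (\<lambda>n. blinfun_apply (f n) x) \<longlonglongrightarrow> 0)"

definition bounded_linear_on :: "'a::real_normed_vector set \<Rightarrow> ('a \<Rightarrow> real) \<Rightarrow> bool" where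
  "bounded_linear_on M \<phi> \<longleftrightarrow>
     (\<forall>x\<in>M. \<forall>y\<in>M. \<phi> (x + y) = \<phi> x + \<phi> y) \<and>
     (\<forall>c. \<forall>x\<in>M. \<phi> (c *\<^sub>R x) = c * \<phi> x) \<and>
     (\<exists>K. \<forall>x\<in>M. \<bar>\<phi> x\<bar> \<le> K * norm x)"

definition weak_topology_on :: "'a::real_normed_vector set \<Rightarrow> 'a topology" where
  "weak_topology_on M =
     topology_generated_by {{x\<in>M. \<phi> x \<in> U} | \<phi> U. bounded_linear_on M \<phi> \<and> open U}"

definition rel_weakly_compact_in :: "'a::real_normed_vector set \<Rightarrow> 'a set \<Rightarrow> bool" where
  "rel_weakly_compact_in M A \<longleftrightarrow>
     A \<subseteq> M \<and> compactin (weak_topology_on M) ((weak_topology_on M) closure_of A)"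

section \<open>The space c_0, as a subspace of l_infinity = (nat =>C real)\<close>

definition c0_space :: "(nat \<Rightarrow>\<^sub>C real) set" where
  "c0_space = {f. (\<lambda>n. apply_bcontfun f n) \<longlonglongrightarrow> 0}"

definition c0_op :: "(nat \<Rightarrow> ('a::real_normed_vector \<Rightarrow>\<^sub>L real)) \<Rightarrow> 'a \<Rightarrow> (nat \<Rightarrow>\<^sub>C real)" where
  "c0_op f x = Bcontfun (\<lambda>n. blinfun_apply (f n) x)"

definition almost_grothendieck_set :: "'a::banach_lattice set \<Rightarrow> bool" where
  "almost_grothendieck_set A \<longleftrightarrow>
     (\<forall>f. weak_star_null f \<and> disjoint_seq f \<longrightarrow> rel_weakly_compact_in c0_space (c0_op f ` A))"

definition almost_grothendieck_op :: "('x::real_normed_vector \<Rightarrow>\<^sub>L 'a::banach_lattice) \<Rightarrow> bool" where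
  "almost_grothendieck_op T \<longleftrightarrow>
     (\<forall>y. weak_star_null y \<and> disjoint_seq y \<longrightarrow>
        (\<forall>\<Phi> :: ('x \<Rightarrow>\<^sub>L real) \<Rightarrow> real. bounded_linear \<Phi> \<longrightarrow>
            (\<lambda>n. \<Phi> (y n o\<^sub>L T)) \<longlonglongrightarrow> 0))"

definition weakly_compact_op :: "('x::real_normed_vector \<Rightarrow>\<^sub>L 'a::real_normed_vector) \<Rightarrow> bool" where
  "weakly_compact_op T \<longleftrightarrow> rel_weakly_compact_in UNIV (blinfun_apply T ` cball 0 1)"

typedef l1 = "{f :: nat \<Rightarrow> real. summable (\<lambda>n. \<bar>f n\<bar>)}"
  morphisms l1_apply Abs_l1
  by (rule exI[of _ "\<lambda>_. 0"]) simp

setup_lifting type_definition_l1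

instantiation l1 :: real_vector
begin
lift_definition zero_l1 :: l1 is "\<lambda>_. 0" by simp
lift_definition plus_l1 :: "l1 \<Rightarrow> l1 \<Rightarrow> l1" is "\<lambda>f g n. f n + g n"
proof -
  fix f g :: "nat \<Rightarrow> real" assume "summable (\<lambda>n. \<bar>f n\<bar>)" "summable (\<lambda>n. \<bar>g n\<bar>)"
  then have "summable (\<lambda>n. \<bar>f n\<bar> + \<bar>g n\<bar>)" by (rule summable_add)
  then show "summable (\<lambda>n. \<bar>f n + g n\<bar>)"
    by (rule summable_comparison_test') (auto intro: abs_triangle_ineq)
qed
lift_definition uminus_l1 :: "l1 \<Rightarrow> l1" is "\<lambda>f n. - f n" by simp
lift_definition minus_l1 :: "l1 \<Rightarrow> l1 \<Rightarrow> l1" is "\<lambda>f g n. f n - g n"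
proof -
  fix f g :: "nat \<Rightarrow> real" assume "summable (\<lambda>n. \<bar>f n\<bar>)" "summable (\<lambda>n. \<bar>g n\<bar>)"
  then have "summable (\<lambda>n. \<bar>f n\<bar> + \<bar>g n\<bar>)" by (rule summable_add)
  then show "summable (\<lambda>n. \<bar>f n - g n\<bar>)"
    by (rule summable_comparison_test') (auto intro: abs_triangle_ineq4)
qed
lift_definition scaleR_l1 :: "real \<Rightarrow> l1 \<Rightarrow> l1" is "\<lambda>c f n. c * f n"
  by (simp add: abs_mult summable_mult)
instance
  by standard (transfer; auto simp: algebra_simps)+
end

instantiation l1 :: real_normed_vector
begin
lift_definition norm_l1 :: "l1 \<Rightarrow> real" is "\<lambda>f. \<Sum>n. \<bar>f n\<bar>" .
definition dist_l1 :: "l1 \<Rightarrow> l1 \<Rightarrow> real" where "dist_l1 x y = norm (x - y)"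
definition sgn_l1 :: "l1 \<Rightarrow> l1" where "sgn_l1 x = x /\<^sub>R norm x"
definition uniformity_l1 :: "(l1 \<times> l1) filter" where
  "uniformity_l1 = (INF e\<in>{0<..}. principal {(x, y). dist x y < e})"
definition open_l1 :: "l1 set \<Rightarrow> bool" where
  "open_l1 U = (\<forall>x\<in>U. \<forall>\<^sub>F (x', y) in uniformity. x' = x \<longrightarrow> y \<in> U)"
instance
proof
  fix x y :: l1 and a :: real
  show "norm x = 0 \<longleftrightarrow> x = 0"
  proof transfer
    fix f :: "nat \<Rightarrow> real" assume "summable (\<lambda>n. \<bar>f n\<bar>)"
    then show "(\<Sum>n. \<bar>f n\<bar>) = 0 \<longleftrightarrow> f = (\<lambda>_. 0)"
      by (auto simp: suminf_eq_zero_iff)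
  qed
  show "norm (x + y) \<le> norm x + norm y"
  proof transfer
    fix f g :: "nat \<Rightarrow> real"
    assume f: "summable (\<lambda>n. \<bar>f n\<bar>)" and g: "summable (\<lambda>n. \<bar>g n\<bar>)"
    have s: "summable (\<lambda>n. \<bar>f n\<bar> + \<bar>g n\<bar>)" using f g by (rule summable_add)
    have "summable (\<lambda>n. \<bar>f n + g n\<bar>)"
      by (rule summable_comparison_test'[OF s]) (auto intro: abs_triangle_ineq)
    then have "(\<Sum>n. \<bar>f n + g n\<bar>) \<le> (\<Sum>n. \<bar>f n\<bar> + \<bar>g n\<bar>)"
      using s by (intro suminf_le) (auto intro: abs_triangle_ineq)
    also have "\<dots> = (\<Sum>n. \<bar>f n\<bar>) + (\<Sum>n. \<bar>g n\<bar>)" using f g by (rule suminf_add[symmetric])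
    finally show "(\<Sum>n. \<bar>f n + g n\<bar>) \<le> (\<Sum>n. \<bar>f n\<bar>) + (\<Sum>n. \<bar>g n\<bar>)" .
  qed
  show "norm (a *\<^sub>R x) = \<bar>a\<bar> * norm x"
    by transfer (simp add: abs_mult suminf_mult)
qed (simp_all add: dist_l1_def sgn_l1_def uniformity_l1_def open_l1_def)
end

end

theory Submission
  imports Defs
begin

text \<open>
  (1) implies (2) because \<open>T\<close> maps the unit ball to an almost Grothendieck set: if \<open>f\<^sub>n \<circ> T \<rightarrow> 0\<close>
  weakly in \<open>X'\<close>, then \<open>\<Phi> \<mapsto> (\<Phi> (f\<^sub>n \<circ> T))\<^sub>n\<close> is a weak*-to-weak continuous map from the unit ball of
  \<open>X''\<close> into \<open>c\<^sub>0\<close>, so its image is weakly compact by Banach--Alaoglu.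

  For (3) implies (1), an almost Grothendieck set \<open>A\<close> is bounded, because \<open>(f, 0, 0, \<dots>)\<close> is disjoint
  for every \<open>f\<close>. If \<open>A\<close> is not relatively weakly compact, some \<open>z \<in> E''\<close> outside \<open>E\<close> lies in
  its weak* closure, and \<open>z\<close> yields \<open>x\<^sub>n \<in> A\<close> and \<open>f\<^sub>k\<close> in the dual ball with \<open>f\<^sub>k x\<^sub>n > \<theta>\<close> for
  \<open>k \<le> n\<close> and \<open>f\<^sub>k x\<^sub>n = 0\<close> for \<open>k > n\<close>; such a sequence is never relatively weakly compact. Hence it
  suffices that the operator \<open>T e\<^sub>n = x\<^sub>n\<close> on \<open>\<ell>\<^sub>1\<close> is almost Grothendieck. A functional \<open>\<Phi>\<close> on
  \<open>\<ell>\<^sub>\<infinity>\<close> is a finitely additive measure on \<open>\<nat>\<close>; if \<open>\<Phi> (g\<^sub>n \<circ> T)\<close> does not tend to \<open>0\<close>, the sets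
  \<open>{k. \<bar>g\<^sub>n x\<^sub>k\<bar> > \<eta>}\<close> have variation bounded below along a subsequence. This produces indices \<open>k\<^sub>j\<close>
  for which every weak cluster point of \<open>S (x (k\<^sub>j))\<close>, where \<open>S x = (g\<^sub>n x)\<^sub>n\<close>, has infinitely many
  coordinates of modulus at least \<open>\<eta>\<close>, so it is not in \<open>c\<^sub>0\<close>.
\<close>

section \<open>The Hahn--Banach theorem\<close>

definition sublinear :: "('a::real_vector \<Rightarrow> real) \<Rightarrow> bool" where
  "sublinear p \<longleftrightarrow> (\<forall>x y. p (x + y) \<le> p x + p y) \<and> (\<forall>t x. 0 \<le> t \<longrightarrow> p (t *\<^sub>R x) = t * p x)"

lemma sublinear_add: "sublinear p \<Longrightarrow> p (x + y) \<le> p x + p y"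
  and sublinear_scale: "sublinear p \<Longrightarrow> 0 \<le> t \<Longrightarrow> p (t *\<^sub>R x) = t * p x"
  by (auto simp: sublinear_def)

lemma sublinear_0: "sublinear p \<Longrightarrow> p 0 = 0"
  using sublinear_scale[of p 0 0] by simp

lemma sublinear_ge_uminus: "sublinear p \<Longrightarrow> - p (- x) \<le> p x"
  using sublinear_add[of p x "- x"] sublinear_0[of p] by simp

lemma sublinearI:
  assumes "\<And>x y. p (x + y) \<le> p x + p y" "p 0 = 0"
    and "\<And>t x. 0 < t \<Longrightarrow> p (t *\<^sub>R x) \<le> t * p x"
  shows "sublinear p"
  unfolding sublinear_def
proof (intro conjI allI impI)
  show "p (x + y) \<le> p x + p y" for x y by (fact assms(1))
  fix t :: real and x assume "0 \<le> t"
  show "p (t *\<^sub>R x) = t * p x"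
  proof (cases "t = 0")
    case True
    then show ?thesis using assms(2) by simp
  next
    case False
    with \<open>0 \<le> t\<close> have "0 < t" by simp
    then have "p x \<le> inverse t * p (t *\<^sub>R x)" using assms(3)[of "inverse t" "t *\<^sub>R x"] by simp
    then have "t * p x \<le> p (t *\<^sub>R x)" using \<open>0 < t\<close> by (simp add: field_simps)
    with assms(3)[OF \<open>0 < t\<close>, of x] show ?thesis by simp
  qed
qed

lemma sublinear_norm: "0 \<le> c \<Longrightarrow> sublinear (\<lambda>x::'a::real_normed_vector. c * norm x)"
  unfolding sublinear_def
  by (metis abs_of_nonneg distrib_left mult.left_commute mult_left_mono norm_scaleR norm_triangle_ineq)

text \<open>A convex cone with a superadditive minorant covers three cases at once: a ray, a
  subspace with \<open>f = 0\<close>, and a subspace with linear \<open>f\<close>. They serve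
  tightness at a point, separation and extension.\<close>

locale cone_minorant =
  fixes p :: "'a::real_vector \<Rightarrow> real" and C :: "'a set" and f :: "'a \<Rightarrow> real"
  assumes sublin: "sublinear p" and zero: "0 \<in> C"
    and add: "\<And>x y. x \<in> C \<Longrightarrow> y \<in> C \<Longrightarrow> x + y \<in> C \<and> f x + f y \<le> f (x + y)"
    and scale: "\<And>t x. 0 \<le> t \<Longrightarrow> x \<in> C \<Longrightarrow> t *\<^sub>R x \<in> C \<and> f (t *\<^sub>R x) = t * f x"
    and le: "\<And>x. x \<in> C \<Longrightarrow> f x \<le> p x"
begin

text \<open>The largest sublinear functional \<open>q\<close> below \<open>p\<close> with
  \<open>q (- c) \<le> - f c\<close> on \<open>C\<close>; a linear functional below it therefore
  lies above \<open>f\<close> on \<open>C\<close>.\<close>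

definition reduct :: "'a \<Rightarrow> real" where
  "reduct x = (INF c\<in>C. p (x + c) - f c)"

text \<open>Since \<open>f c \<le> p c \<le> p (x + c) + p (- x)\<close>, the infimum in
  \<open>reduct\<close> is taken over a set that is bounded below.\<close>

lemma reduct_term_ge: "c \<in> C \<Longrightarrow> - p (- x) \<le> p (x + c) - f c"
  using sublinear_add[OF sublin, of "x + c" "- x"] le[of c] by (simp add: algebra_simps)

lemma reduct_le: "c \<in> C \<Longrightarrow> reduct x \<le> p (x + c) - f c"
  unfolding reduct_def
  by (rule cINF_lower) (auto intro!: bdd_belowI2 reduct_term_ge)

lemma reduct_greatest: "(\<And>c. c \<in> C \<Longrightarrow> b \<le> p (x + c) - f c) \<Longrightarrow> b \<le> reduct x"
  unfolding reduct_def using zero by (intro cINF_greatest) auto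

lemma f_0: "f 0 = 0"
  using scale[OF _ zero, of 0] by simp

lemma reduct_le_p: "reduct x \<le> p x"
  using reduct_le[OF zero, of x] f_0 by simp

lemma reduct_uminus: "c \<in> C \<Longrightarrow> reduct (- c) \<le> - f c"
  using reduct_le[of c "- c"] sublinear_0[OF sublin] by simp

lemma sublinear_reduct: "sublinear reduct"
proof (rule sublinearI)
  fix x y
  have "reduct (x + y) - (p (x + c) - f c) \<le> p (y + d) - f d" if "c \<in> C" "d \<in> C" for c d
    using reduct_le[of "c + d" "x + y"] add[OF that] sublinear_add[OF sublin, of "x + c" "y + d"]
    by (simp add: algebra_simps)
  then have "reduct (x + y) - (p (x + c) - f c) \<le> reduct y" if "c \<in> C" for c
    using that by (intro reduct_greatest) auto
  then have "reduct (x + y) - reduct y \<le> reduct x"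
    by (intro reduct_greatest) (simp add: algebra_simps)
  then show "reduct (x + y) \<le> reduct x + reduct y" by simp
next
  have "0 \<le> reduct 0"
    using reduct_term_ge[of _ 0] sublinear_0[OF sublin] by (intro reduct_greatest) auto
  then show "reduct 0 = 0" using reduct_le_p[of 0] sublinear_0[OF sublin] by simp
next
  fix t :: real and x :: 'a assume t: "0 < t"
  have "reduct (t *\<^sub>R x) / t \<le> reduct x"
  proof (rule reduct_greatest)
    fix c assume "c \<in> C"
    then have "reduct (t *\<^sub>R x) \<le> p (t *\<^sub>R x + t *\<^sub>R c) - f (t *\<^sub>R c)" "f (t *\<^sub>R c) = t * f c"
      using scale[of t c] t reduct_le[of "t *\<^sub>R c" "t *\<^sub>R x"] by auto
    moreover have "p (t *\<^sub>R x + t *\<^sub>R c) = t * p (x + c)"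
      using sublinear_scale[OF sublin, of t "x + c"] t by (simp add: scaleR_add_right)
    ultimately show "reduct (t *\<^sub>R x) / t \<le> p (x + c) - f c"
      using t by (simp add: field_simps)
  qed
  then show "reduct (t *\<^sub>R x) \<le> t * reduct x" using t by (simp add: field_simps)
qed

end

lemma cone_minorant_ray:
  assumes p: "sublinear p"
  shows "cone_minorant p ((\<lambda>t. t *\<^sub>R b) ` {0..}) p"
proof
  show "0 \<in> (\<lambda>t. t *\<^sub>R b) ` {0..}" by (rule image_eqI[of _ _ 0]) auto
  fix u v assume "u \<in> (\<lambda>t. t *\<^sub>R b) ` {0..}" "v \<in> (\<lambda>t. t *\<^sub>R b) ` {0..}"
  then obtain s t where st: "u = s *\<^sub>R b" "v = t *\<^sub>R b" "0 \<le> s" "0 \<le> t" by auto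
  then have uv: "u + v = (s + t) *\<^sub>R b" by (simp add: scaleR_add_left)
  then have "p (u + v) = p u + p v"
    using st p sublinear_scale[OF p, of "s + t" b] by (simp add: sublinear_scale distrib_right)
  moreover have "u + v \<in> (\<lambda>t. t *\<^sub>R b) ` {0..}"
    using uv st by (intro image_eqI[of _ _ "s + t"]) auto
  ultimately show "u + v \<in> (\<lambda>t. t *\<^sub>R b) ` {0..} \<and> p u + p v \<le> p (u + v)" by simp
next
  fix t :: real and u assume t: "0 \<le> t" and "u \<in> (\<lambda>t. t *\<^sub>R b) ` {0..}"
  then show "t *\<^sub>R u \<in> (\<lambda>t. t *\<^sub>R b) ` {0..} \<and> p (t *\<^sub>R u) = t * p u"
    using sublinear_scale[OF p t] by auto
qed (use p in auto)

text \<open>Zorn's lemma yields a minimal sublinear functional below \<open>p\<close>, and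
  minimality forces linearity.\<close>

lemma sublinear_dominates_linear:
  fixes p :: "'a::real_vector \<Rightarrow> real"
  assumes p: "sublinear p"
  obtains g where "linear g" "\<And>x. g x \<le> p x"
proof -
  define A where "A = {q. sublinear q \<and> q \<le> p}"
  have "\<exists>m\<in>A. \<forall>q\<in>A. q \<le> m \<longrightarrow> q = m"
  proof (rule predicate_Zorn)
    \<comment> \<open>The order is reversed, so that bounds of chains are lower bounds and maximal
      elements are minimal functionals.\<close>
    show "partial_order_on A (relation_of (\<lambda>a b. b \<le> a) A)"
      unfolding partial_order_on_def preorder_on_def relation_of_def
      by (auto simp: refl_on_def trans_def antisym_def)
    fix K assume "K \<in> Chains (relation_of (\<lambda>a b. b \<le> a) A)"
    then have KA: "\<And>q. q \<in> K \<Longrightarrow> sublinear q \<and> (\<forall>x. q x \<le> p x)"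
      and Kc: "\<And>q r. q \<in> K \<Longrightarrow> r \<in> K \<Longrightarrow> q \<le> r \<or> r \<le> q"
      by (auto simp: Chains_def relation_of_def A_def le_fun_def)
    show "\<exists>u\<in>A. \<forall>a\<in>K. u \<le> a"
    proof (cases "K = {}")
      case True
      then show ?thesis using p by (auto simp: A_def)
    next
      case False
      \<comment> \<open>The pointwise infimum is finite because every sublinear \<open>q\<close>
        below \<open>p\<close> satisfies \<open>- p (- x) \<le> q x\<close>.\<close>
      define u where "u x = (INF q\<in>K. q x)" for x
      have "- p (- x) \<le> q x" if "q \<in> K" for q x
        using sublinear_ge_uminus[of q x] KA[OF that] by (smt (verit))
      then have u_le: "u x \<le> q x" if "q \<in> K" for q x
        unfolding u_def using that by (intro cINF_lower) (auto intro!: bdd_belowI2)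
      have u_ge: "b \<le> u x" if "\<And>q. q \<in> K \<Longrightarrow> b \<le> q x" for b x
        unfolding u_def using that False by (intro cINF_greatest) auto
      have "sublinear u"
      proof (rule sublinearI)
        fix x y
        have "u (x + y) - q x \<le> r y" if qr: "q \<in> K" "r \<in> K" for q r
        proof -
          \<comment> \<open>The chain supplies one \<open>s\<close> below both \<open>q\<close> and
            \<open>r\<close>, and its subadditivity bounds \<open>u (x + y)\<close>.\<close>
          obtain s where s: "s \<in> K" "s \<le> q" "s \<le> r" using Kc[OF qr] qr by (meson order_refl)
          then show ?thesis
            using u_le[OF s(1), of "x + y"] KA[OF s(1)] sublinear_add[of s x y]
            by (smt (verit) le_fun_def)
        qed
        then have "u (x + y) - q x \<le> u y" if "q \<in> K" for q
          using that by (intro u_ge) auto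
        then have "u (x + y) - u y \<le> u x" by (intro u_ge) (simp add: algebra_simps)
        then show "u (x + y) \<le> u x + u y" by simp
      next
        show "u 0 = 0" unfolding u_def using KA False by (simp add: sublinear_0)
      next
        fix t :: real and x :: 'a assume t: "0 < t"
        have "u (t *\<^sub>R x) / t \<le> u x"
        proof (rule u_ge)
          fix q assume q: "q \<in> K"
          then have "u (t *\<^sub>R x) \<le> t * q x"
            using u_le[OF q, of "t *\<^sub>R x"] KA[OF q] sublinear_scale[of q t x] t by simp
          then show "u (t *\<^sub>R x) / t \<le> q x" using t by (simp add: field_simps)
        qed
        then show "u (t *\<^sub>R x) \<le> t * u x" using t by (simp add: field_simps)
      qed
      moreover obtain q where "q \<in> K" using False by auto
      ultimately have "u \<in> A"
        using KA by (auto simp: A_def le_fun_def intro: order_trans[OF u_le])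
      then show ?thesis using u_le by (auto simp: le_fun_def)
    qed
  qed
  then obtain m where m: "sublinear m" "m \<le> p" and min: "\<And>q. sublinear q \<Longrightarrow> q \<le> m \<Longrightarrow> q = m"
    unfolding A_def by (metis (mono_tags, lifting) mem_Collect_eq order_trans)
  \<comment> \<open>A minimal sublinear functional coincides with its reduct along every ray, so
    \<open>m x \<le> m (x + y) - m y\<close>.\<close>
  have add: "m (x + y) = m x + m y" for x y
  proof -
    interpret cone_minorant m "(\<lambda>t. t *\<^sub>R y) ` {0..}" m by (rule cone_minorant_ray[OF m(1)])
    have y: "y \<in> (\<lambda>t. t *\<^sub>R y) ` {0..}" by (rule image_eqI[of _ _ 1]) auto
    have "reduct = m" by (rule min[OF sublinear_reduct]) (simp add: le_fun_def reduct_le_p)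
    then have "m x \<le> m (x + y) - m y" using reduct_le[OF y, of x] by simp
    with sublinear_add[OF m(1), of x y] show ?thesis by simp
  qed
  have neg: "m (- x) = - m x" for x using add[of x "- x"] sublinear_0[OF m(1)] by simp
  have "linear m"
  proof (rule linearI)
    fix r :: real and x :: 'a
    show "m (r *\<^sub>R x) = r *\<^sub>R m x"
      using sublinear_scale[OF m(1), of r x] sublinear_scale[OF m(1), of "- r" x] neg[of "r *\<^sub>R x"]
      by (cases "0 \<le> r") auto
  qed (fact add)
  then show thesis using that m(2) by (auto simp: le_fun_def)
qed

lemma (in cone_minorant) ex_linear_between:
  obtains g where "linear g" "\<And>x. g x \<le> p x" "\<And>c. c \<in> C \<Longrightarrow> f c \<le> g c"
proof -
  obtain g where g: "linear g" "\<And>x. g x \<le> reduct x"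
    using sublinear_dominates_linear[OF sublinear_reduct] by blast
  have "f c \<le> g c" if "c \<in> C" for c
    using g(2)[of "- c"] reduct_uminus[OF that] linear_neg[OF g(1), of c] by simp
  moreover have "g x \<le> p x" for x using g(2)[of x] reduct_le_p[of x] by simp
  ultimately show thesis using that g(1) by blast
qed

text \<open>With the ray through \<open>b\<close> as cone and \<open>p\<close> itself as minorant,
  the upper and the lower bound meet at \<open>b\<close>.\<close>

lemma sublinear_tight_linear:
  fixes p :: "'a::real_vector \<Rightarrow> real"
  assumes p: "sublinear p"
  obtains g where "linear g" "\<And>x. g x \<le> p x" "g b = p b"
proof -
  interpret cone_minorant p "(\<lambda>t. t *\<^sub>R b) ` {0..}" p by (rule cone_minorant_ray[OF p])
  obtain g where "linear g" "\<And>x. g x \<le> p x" "\<And>c. c \<in> (\<lambda>t. t *\<^sub>R b) ` {0..} \<Longrightarrow> p c \<le> g c"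
    using ex_linear_between by blast
  moreover have "b \<in> (\<lambda>t. t *\<^sub>R b) ` {0..}" by (rule image_eqI[of _ _ 1]) auto
  ultimately show thesis using that[of g] by (meson antisym)
qed

lemma linear_le_norm_abs:
  fixes g :: "'a::real_normed_vector \<Rightarrow> real"
  assumes "linear g" "\<And>x. g x \<le> c * norm x"
  shows "\<bar>g x\<bar> \<le> c * norm x"
  using assms(2)[of x] assms(2)[of "- x"] linear_neg[OF assms(1), of x] by simp

lemma ex_norming_functional:
  fixes x :: "'a::real_normed_vector"
  obtains g :: "'a \<Rightarrow>\<^sub>L real" where "norm g \<le> 1" "g x = norm x"
proof -
  obtain g where g: "linear g" "\<And>y. g y \<le> 1 * norm y" "g x = 1 * norm x"
    using sublinear_tight_linear[OF sublinear_norm[of 1]] zero_le_one by blast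
  then have ab: "\<bar>g y\<bar> \<le> norm y" for y using linear_le_norm_abs[of g 1 y] by simp
  then have bl: "bounded_linear g"
    using g(1) by (auto simp: bounded_linear_def bounded_linear_axioms_def intro!: exI[of _ 1])
  show thesis
    using g(3) ab by (intro that[of "Blinfun g"] norm_blinfun_bound) (auto simp: bounded_linear_Blinfun_apply[OF bl])
qed

text \<open>For the minorant \<open>0\<close> on \<open>M\<close>, \<open>reduct\<close> is the
  distance to \<open>M\<close>. A linear functional tight at \<open>b\<close> has value at least
  \<open>d\<close> there, while \<open>reduct \<le> 0\<close> on the subspace \<open>M\<close> makes
  it vanish on \<open>M\<close>.\<close>

lemma ex_separating_functional:
  fixes b :: "'a::real_normed_vector"
  assumes M: "subspace M" and d: "0 < d" "\<And>y. y \<in> M \<Longrightarrow> d \<le> norm (b - y)"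
  obtains g :: "'a \<Rightarrow>\<^sub>L real" where "\<And>y. y \<in> M \<Longrightarrow> g y = 0" "0 < g b"
proof -
  interpret cone_minorant "\<lambda>x. 1 * norm x" M "\<lambda>x. 0"
    using M sublinear_norm[of 1]
    by unfold_locales (auto intro: subspace_add subspace_scale subspace_0 simp del: mult_1)
  obtain g where g: "linear g" "\<And>y. g y \<le> reduct y" "g b = reduct b"
    using sublinear_tight_linear[OF sublinear_reduct] by blast
  have "g y \<le> norm y" for y using g(2)[of y] reduct_le_p[of y] by simp
  then have ab: "\<bar>g y\<bar> \<le> norm y" for y using linear_le_norm_abs[of g 1 y] g(1) by simp
  have bl: "bounded_linear g"
    using ab g(1) by (auto simp: bounded_linear_def bounded_linear_axioms_def intro!: exI[of _ 1])
  have "d \<le> g b" unfolding g(3)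
    using d(2) subspace_neg[OF M] by (intro reduct_greatest) (metis diff_0_right diff_minus_eq_add mult_1)
  moreover have le0: "g y \<le> 0" if "y \<in> M" for y
    using g(2)[of y] reduct_uminus[of "- y"] subspace_neg[OF M that] by simp
  then have "g y = 0" if "y \<in> M" for y
    using le0[OF that] le0[OF subspace_neg[OF M that]] linear_neg[OF g(1), of y] by simp
  ultimately show thesis
    using d(1) by (intro that[of "Blinfun g"]) (auto simp: bounded_linear_Blinfun_apply[OF bl])
qed

text \<open>Here \<open>z\<close> is controlled on \<open>M\<close> only. A functional above
  \<open>z\<close> on \<open>M\<close> agrees with it there, because \<open>M\<close> is closed
  under negation.\<close>

lemma ex_linear_extension:
  fixes z :: "'a::real_normed_vector \<Rightarrow> real"
  assumes M: "subspace M" and z: "linear z" and c: "0 \<le> c" and b: "\<And>x. x \<in> M \<Longrightarrow> \<bar>z x\<bar> \<le> c * norm x"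
  obtains g where "linear g" "\<And>x. \<bar>g x\<bar> \<le> c * norm x" "\<And>x. x \<in> M \<Longrightarrow> g x = z x"
proof -
  interpret cone_minorant "\<lambda>x. c * norm x" M z
    using M z b sublinear_norm[OF c]
    by unfold_locales (auto intro: subspace_add subspace_scale subspace_0 simp: abs_le_iff linear_add linear_scale)
  obtain g where g: "linear g" "\<And>x. g x \<le> c * norm x" "\<And>x. x \<in> M \<Longrightarrow> z x \<le> g x"
    using ex_linear_between by blast
  have "g x = z x" if "x \<in> M" for x
    using g(3)[OF that] g(3)[OF subspace_neg[OF M that]] linear_neg[OF g(1), of x] linear_neg[OF z, of x] by simp
  then show thesis using that g linear_le_norm_abs[OF g(1,2)] by blast
qed

section \<open>Weak topologies and uniform boundedness\<close>

lemma bounded_linear_on_UNIV: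
  "bounded_linear_on UNIV \<phi> \<longleftrightarrow> bounded_linear \<phi>"
proof
  assume \<phi>: "bounded_linear_on UNIV \<phi>"
  then obtain K where "\<And>x. \<bar>\<phi> x\<bar> \<le> K * norm x" by (auto simp: bounded_linear_on_def)
  then show "bounded_linear \<phi>"
    using \<phi> by (intro bounded_linear_intro[of _ K]) (auto simp: bounded_linear_on_def mult.commute)
next
  assume "bounded_linear \<phi>"
  then interpret bounded_linear \<phi> .
  show "bounded_linear_on UNIV \<phi>"
    unfolding bounded_linear_on_def using add scaleR bounded by (auto simp: mult.commute)
qed

lemma topspace_weak_topology_on [simp]: "topspace (weak_topology_on M) = M"
proof -
  have "bounded_linear_on M (\<lambda>x. 0)" by (auto simp: bounded_linear_on_def intro!: exI[of _ 0])
  then have "{x\<in>M. (0::real) \<in> UNIV} \<in> {{x\<in>M. \<phi> x \<in> U} | \<phi> U. bounded_linear_on M \<phi> \<and> open U}"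
    by blast
  then show ?thesis unfolding weak_topology_on_def by auto
qed

lemma openin_weak_topology_on:
  "bounded_linear_on M \<phi> \<Longrightarrow> open U \<Longrightarrow> openin (weak_topology_on M) {x\<in>M. \<phi> x \<in> U}"
  unfolding weak_topology_on_def by (rule topology_generated_by_Basis) blast

lemma continuous_map_weak_topology_on:
  assumes "h \<in> topspace X \<rightarrow> M"
    and "\<And>\<phi>. bounded_linear_on M \<phi> \<Longrightarrow> continuous_map X euclideanreal (\<phi> \<circ> h)"
  shows "continuous_map X (weak_topology_on M) h"
  unfolding weak_topology_on_def
proof (rule continuous_on_generated_topo)
  show "h ` topspace X \<subseteq> \<Union> {{x\<in>M. \<phi> x \<in> U} | \<phi> U. bounded_linear_on M \<phi> \<and> open U}"
    using assms(1) topspace_weak_topology_on[of M, unfolded weak_topology_on_def] by auto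
  fix V assume "V \<in> {{x\<in>M. \<phi> x \<in> U} | \<phi> U. bounded_linear_on M \<phi> \<and> open U}"
  then obtain \<phi> U where V: "V = {x\<in>M. \<phi> x \<in> U}" "bounded_linear_on M \<phi>" "open U" by blast
  then have "openin X {x \<in> topspace X. (\<phi> \<circ> h) x \<in> U}"
    using openin_continuous_map_preimage[OF assms(2)] by auto
  moreover have "h -` V \<inter> topspace X = {x \<in> topspace X. (\<phi> \<circ> h) x \<in> U}"
    using V(1) assms(1) by auto
  ultimately show "openin X (h -` V \<inter> topspace X)" by simp
qed

lemma continuous_map_bounded_linear_on:
  "bounded_linear_on M \<phi> \<Longrightarrow> continuous_map (weak_topology_on M) euclideanreal \<phi>"
  by (simp add: continuous_map_def openin_weak_topology_on)

lemma Hausdorff_space_weak_topology_on: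
  assumes "\<And>x y. x \<in> M \<Longrightarrow> y \<in> M \<Longrightarrow> x \<noteq> y \<Longrightarrow> \<exists>\<phi>. bounded_linear_on M \<phi> \<and> \<phi> x \<noteq> \<phi> y"
  shows "Hausdorff_space (weak_topology_on M)"
  unfolding Hausdorff_space_def topspace_weak_topology_on
proof (intro allI impI)
  fix x y assume xy: "x \<in> M \<and> y \<in> M \<and> x \<noteq> y"
  then obtain \<phi> where \<phi>: "bounded_linear_on M \<phi>" "\<phi> x \<noteq> \<phi> y" using assms by blast
  then obtain U V where "open U" "open V" "\<phi> x \<in> U" "\<phi> y \<in> V" "U \<inter> V = {}"
    using hausdorff by metis
  then show "\<exists>U V. openin (weak_topology_on M) U \<and> openin (weak_topology_on M) V \<and> x \<in> U \<and> y \<in> V \<and> disjnt U V"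
    using xy openin_weak_topology_on[OF \<phi>(1)]
    by (intro exI[of _ "{x\<in>M. \<phi> x \<in> U}"] exI[of _ "{x\<in>M. \<phi> x \<in> V}"]) (auto simp: disjnt_iff)
qed

lemma rel_weakly_compact_in_subset_compact:
  assumes "Hausdorff_space (weak_topology_on M)" "compactin (weak_topology_on M) K" "A \<subseteq> K"
  shows "rel_weakly_compact_in M A"
proof -
  have "closedin (weak_topology_on M) K" using assms by (simp add: compactin_imp_closedin)
  then have "weak_topology_on M closure_of A \<subseteq> K" using assms(3) by (rule closure_of_minimal[rotated])
  then show ?thesis
    unfolding rel_weakly_compact_in_def
    using assms compactin_subset_topspace[OF assms(2)] by (auto intro: closed_compactin)
qed

lemma rel_weakly_compact_in_mono:
  assumes "rel_weakly_compact_in M B" "A \<subseteq> B"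
  shows "rel_weakly_compact_in M A"
  using assms closure_of_mono[OF assms(2), of "weak_topology_on M"]
  unfolding rel_weakly_compact_in_def by (auto intro: closed_compactin)

text \<open>Otherwise each point of \<open>K\<close> has a neighbourhood missed by a tail of
  \<open>s\<close>, and a finite subcover would be missed by a common tail.\<close>

lemma compactin_cluster_point:
  assumes K: "compactin X K" and s: "\<And>n::nat. s n \<in> K"
  obtains b where "b \<in> K" "\<And>U N. openin X U \<Longrightarrow> b \<in> U \<Longrightarrow> \<exists>n\<ge>N. s n \<in> U"
proof (rule ccontr)
  assume "\<not> thesis"
  then have "\<forall>b\<in>K. \<exists>P. openin X (fst P) \<and> b \<in> fst P \<and> (\<forall>n\<ge>snd P. s n \<notin> fst P)"
    using that by simp meson
  \<comment> \<open>Pairs let a single choice function pick the neighbourhood together with its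
    threshold.\<close>
  then obtain P where "\<forall>b\<in>K. openin X (fst (P b)) \<and> b \<in> fst (P b) \<and> (\<forall>n\<ge>snd (P b). s n \<notin> fst (P b))"
    by (rule bchoice[THEN exE])
  then obtain U N where U: "\<And>b. b \<in> K \<Longrightarrow> openin X (U b)" "\<And>b. b \<in> K \<Longrightarrow> b \<in> U b"
      and N: "\<And>b n. b \<in> K \<Longrightarrow> N b \<le> n \<Longrightarrow> s n \<notin> U b"
    using that[of "\<lambda>b. fst (P b)" "\<lambda>b. snd (P b)"] by auto
  have "Ball (U ` K) (openin X) \<and> K \<subseteq> \<Union> (U ` K)" using U by auto
  then obtain F where F: "finite F" "F \<subseteq> U ` K" "K \<subseteq> \<Union>F"
    using K unfolding compactin_def by meson
  then obtain B where B: "finite B" "B \<subseteq> K" "F = U ` B" by (meson finite_subset_image)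
  define m where "m = Max (insert 0 (N ` B))"
  have "N b \<le> m" if "b \<in> B" for b unfolding m_def using B(1) that by auto
  then have "s m \<notin> U b" if "b \<in> B" for b using N B(2) that by auto
  then show False using F(3) B(3) s[of m] by auto
qed

lemma rel_weakly_compact_in_cluster_point:
  assumes "rel_weakly_compact_in M A" "\<And>n::nat. s n \<in> A"
  obtains b where "b \<in> M" "\<And>U N. openin (weak_topology_on M) U \<Longrightarrow> b \<in> U \<Longrightarrow> \<exists>n\<ge>N. s n \<in> U"
proof -
  let ?X = "weak_topology_on M"
  have AM: "A \<subseteq> M" and K: "compactin ?X (?X closure_of A)"
    using assms(1) by (auto simp: rel_weakly_compact_in_def)
  then have sK: "s n \<in> ?X closure_of A" for n
    using assms(2) closure_of_subset[of A ?X] by auto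
  have KM: "?X closure_of A \<subseteq> M" using closure_of_subset_topspace[of ?X A] by simp
  show thesis
    by (rule compactin_cluster_point[OF K sK]) (rule that[OF subsetD[OF KM]])
qed

lemma rel_weakly_compact_in_bounded_image:
  assumes "rel_weakly_compact_in M A" "bounded_linear_on M \<phi>"
  shows "bounded (\<phi> ` A)"
proof -
  let ?X = "weak_topology_on M"
  have AM: "A \<subseteq> M" and K: "compactin ?X (?X closure_of A)"
    using assms(1) by (auto simp: rel_weakly_compact_in_def)
  have "compactin euclideanreal (\<phi> ` (?X closure_of A))"
    by (rule image_compactin[OF K continuous_map_bounded_linear_on[OF assms(2)]])
  then have "bounded (\<phi> ` (?X closure_of A))" by (simp add: compact_imp_bounded)
  then show ?thesis
    using AM closure_of_subset[of A ?X] by (auto intro: bounded_subset)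
qed

section \<open>Uniform boundedness and its consequences\<close>

lemma uniform_boundedness:
  fixes F :: "('a::banach \<Rightarrow>\<^sub>L real) set"
  assumes "\<And>x. \<exists>c. \<forall>f\<in>F. \<bar>f x\<bar> \<le> c"
  obtains C where "0 < C" "\<And>f. f \<in> F \<Longrightarrow> norm f \<le> C"
proof -
  define V where "V n = {x. \<forall>f\<in>F. \<bar>blinfun_apply f x\<bar> \<le> real n}" for n
  have "V n = (\<Inter>f\<in>F. {x. \<bar>blinfun_apply f x\<bar> \<le> real n})" for n by (auto simp: V_def)
  then have cl: "closed (V n)" for n
    by (auto intro!: closed_INT closed_Collect_le continuous_intros)
  have "(\<Union>n. V n) = UNIV"
    using assms by (auto simp: V_def) (meson order_trans real_arch_simple)
  \<comment> \<open>Baire: countably many closed sets with empty interior cannot cover a Banach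
    space.\<close>
  then have "\<exists>n. interior (V n) \<noteq> {}"
    using Baire_category_alt[of "euclidean :: 'a topology" "range V"] cl
    by (auto simp: completely_metrizable_space_euclidean) blast
  then obtain n a where "a \<in> interior (V n)" by auto
  then obtain r where r: "0 < r" "cball a r \<subseteq> V n" by (auto simp: mem_interior_cball)
  show thesis
  proof
    \<comment> \<open>A bound \<open>2 n\<close> on the sphere of radius \<open>r\<close> gives the
      constant \<open>2 n / r\<close>; using \<open>n + 1\<close> keeps it positive when
      \<open>n = 0\<close>.\<close>
    show "0 < 2 * (real n + 1) / r" using r(1) by simp
    fix f assume f: "f \<in> F"
    show "norm f \<le> 2 * (real n + 1) / r"
    proof (rule norm_blinfun_bound)
      fix x
      show "norm (f x) \<le> 2 * (real n + 1) / r * norm x"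
      proof (cases "x = 0")
        case False
        \<comment> \<open>Scaling \<open>x\<close> to length \<open>r\<close> puts \<open>a\<close>
          and \<open>a + y\<close> in the ball, and \<open>f y\<close> is the difference of the
          values there.\<close>
        define y where "y = (r / norm x) *\<^sub>R x"
        have "norm y = r" using False r(1) by (simp add: y_def)
        then have "a \<in> V n" "a + y \<in> V n" using r by (auto simp: subset_iff dist_norm)
        then have "\<bar>f (a + y)\<bar> \<le> n" "\<bar>f a\<bar> \<le> n" using f by (auto simp: V_def)
        then have "\<bar>f y\<bar> \<le> 2 * n" by (simp add: blinfun.add_right)
        then have "r / norm x * \<bar>f x\<bar> \<le> 2 * n"
          using r(1) by (simp add: y_def blinfun.scaleR_right abs_mult)
        then have "\<bar>f x\<bar> \<le> 2 * real n * norm x / r" using r(1) False by (simp add: field_simps)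
        also have "\<dots> \<le> 2 * (real n + 1) / r * norm x"
          using r(1) by (simp add: field_simps)
        finally show ?thesis by simp
      qed simp
    qed (use r(1) in simp)
  qed
qed

lemma eq_if_all_functionals_eq:
  fixes x y :: "'a::real_normed_vector"
  assumes "\<And>f :: 'a \<Rightarrow>\<^sub>L real. f x = f y"
  shows "x = y"
proof -
  obtain g :: "'a \<Rightarrow>\<^sub>L real" where "g (x - y) = norm (x - y)" using ex_norming_functional by blast
  then show ?thesis using assms[of g] by (simp add: blinfun.diff_right)
qed

text \<open>Under the canonical embedding, \<open>A\<close> becomes a pointwise bounded family of
  functionals on the dual. The dual is complete, so uniform boundedness applies there, and norming
  functionals carry the bound back.\<close>

lemma weakly_bounded_imp_bounded:
  fixes A :: "'a::real_normed_vector set"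
  assumes "\<And>f :: 'a \<Rightarrow>\<^sub>L real. bounded (blinfun_apply f ` A)"
  obtains C where "0 < C" "\<And>a. a \<in> A \<Longrightarrow> norm a \<le> C"
proof -
  define J where "J a = Blinfun (\<lambda>f :: 'a \<Rightarrow>\<^sub>L real. blinfun_apply f a)" for a
  have J: "blinfun_apply (J a) f = blinfun_apply f a" for a f
    unfolding J_def by (simp add: bounded_linear_Blinfun_apply blinfun.bounded_linear_left)
  have "\<exists>c. \<forall>j\<in>J ` A. \<bar>blinfun_apply j f\<bar> \<le> c" for f
    using assms[of f] by (auto simp: J bounded_iff)
  then obtain C where C: "0 < C" "\<And>j. j \<in> J ` A \<Longrightarrow> norm j \<le> C" using uniform_boundedness by blast
  have "norm a \<le> C" if a: "a \<in> A" for a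
  proof -
    obtain g :: "'a \<Rightarrow>\<^sub>L real" where g: "norm g \<le> 1" "g a = norm a" using ex_norming_functional by blast
    have "norm a \<le> \<bar>J a g\<bar>" by (simp add: J g(2))
    also have "\<dots> \<le> norm (J a) * norm g" using norm_blinfun[of "J a" g] by simp
    also have "\<dots> \<le> C * 1" using C a g(1) by (intro mult_mono) auto
    finally show ?thesis by simp
  qed
  then show thesis using that C(1) by blast
qed

lemma weak_star_null_bounded:
  fixes f :: "nat \<Rightarrow> ('a::banach \<Rightarrow>\<^sub>L real)"
  assumes "weak_star_null f"
  obtains C where "0 < C" "\<And>n. norm (f n) \<le> C"
proof -
  have "\<exists>c. \<forall>g\<in>range f. \<bar>blinfun_apply g x\<bar> \<le> c" for x
  proof -
    have "Bseq (\<lambda>n. f n x)"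
      using assms by (auto simp: weak_star_null_def intro: convergent_imp_Bseq convergentI)
    then show ?thesis by (auto simp: Bseq_def)
  qed
  then obtain C where "0 < C" "\<And>g. g \<in> range f \<Longrightarrow> norm g \<le> C"
    using uniform_boundedness by blast
  then show thesis using that by blast
qed

section \<open>Sequences witnessing the failure of weak compactness\<close>

lemma closed_functional_ball:
  "closed {z :: 'a::real_normed_vector \<Rightarrow> real. linear z \<and> (\<forall>x. \<bar>z x\<bar> \<le> C * norm x)}" (is "closed ?Z")
proof -
  have "?Z = (\<Inter>x. \<Inter>y. {z. z (x + y) = z x + z y}) \<inter> (\<Inter>c. \<Inter>x. {z. z (c *\<^sub>R x) = c * z x})
      \<inter> (\<Inter>x. {z. \<bar>z x\<bar> \<le> C * norm x})"
    by (auto simp: linear_iff)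
  moreover have "closed \<dots>"
    by (intro closed_Int closed_INT ballI closed_Collect_eq closed_Collect_le continuous_intros
        continuous_on_product_coordinates)
  ultimately show ?thesis by metis
qed

text \<open>Banach-Alaoglu: with functionals as plain functions, the product topology is the weak*
  topology, and the ball is a closed part of a product of compact intervals.\<close>

lemma compact_functional_ball:
  "compact {z :: 'a::real_normed_vector \<Rightarrow> real. linear z \<and> (\<forall>x. \<bar>z x\<bar> \<le> C * norm x)}" (is "compact ?Z")
proof -
  let ?B = "PiE UNIV (\<lambda>x :: 'a. {- (C * norm x)..C * norm x})"
  have "compactin (product_topology (\<lambda>x. euclideanreal) UNIV) ?B"
    by (rule compactin_PiE[THEN iffD2]) simp
  then have "compact ?B"
    unfolding euclidean_product_topology by simp
  moreover have "?B \<inter> ?Z = ?Z"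
    by (auto simp: PiE_UNIV_domain abs_le_iff minus_le_iff)
  ultimately show ?thesis using compact_Int_closed[OF _ closed_functional_ball[of C], of ?B] by simp
qed

lemma closure_evaluations_subset:
  fixes A :: "'a::real_normed_vector set"
  assumes C: "\<And>a. a \<in> A \<Longrightarrow> norm a \<le> C"
  shows "closure ((\<lambda>a (f :: 'a \<Rightarrow>\<^sub>L real). f a) ` A) \<subseteq> {z. linear z \<and> (\<forall>f. \<bar>z f\<bar> \<le> C * norm f)}"
proof (rule closure_minimal[OF _ closed_functional_ball], clarsimp, intro conjI allI)
  fix a assume a: "a \<in> A"
  show "linear (\<lambda>f. blinfun_apply f a)"
    using blinfun.bounded_linear_left bounded_linear.linear by blast
  fix f :: "'a \<Rightarrow>\<^sub>L real"
  have "\<bar>f a\<bar> \<le> norm f * norm a" using norm_blinfun[of f a] by simp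
  also have "\<dots> \<le> norm f * C" using C[OF a] by (intro mult_left_mono) auto
  finally show "\<bar>f a\<bar> \<le> C * norm f" by (simp add: mult.commute)
qed

lemma Hausdorff_space_weak_topology_on_UNIV:
  "Hausdorff_space (weak_topology_on (UNIV :: 'a::real_normed_vector set))"
proof (rule Hausdorff_space_weak_topology_on)
  fix x y :: 'a assume "x \<noteq> y"
  then obtain f :: "'a \<Rightarrow>\<^sub>L real" where "f x \<noteq> f y" using eq_if_all_functionals_eq by blast
  then show "\<exists>\<phi>. bounded_linear_on UNIV \<phi> \<and> \<phi> x \<noteq> \<phi> y"
    using blinfun.bounded_linear_right[of f] by (auto simp: bounded_linear_on_UNIV)
qed

text \<open>The weak* closure is compact by Banach-Alaoglu and stays in the canonical image, so the
  inverse embedding carries it to a weakly compact set. That inverse is weak*-to-weak continuous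
  because composing it with \<open>\<phi>\<close> gives evaluation at \<open>\<phi>\<close>.\<close>

lemma rel_weakly_compact_in_closure_evaluations:
  fixes A :: "'a::real_normed_vector set"
  defines "J \<equiv> \<lambda>(a::'a) (f :: 'a \<Rightarrow>\<^sub>L real). f a"
  assumes C: "\<And>a. a \<in> A \<Longrightarrow> norm a \<le> C" and cl: "closure (J ` A) \<subseteq> range J"
  shows "rel_weakly_compact_in UNIV A"
proof -
  define K where "K = closure (J ` A)"
  have "K \<subseteq> {z. linear z \<and> (\<forall>f. \<bar>z f\<bar> \<le> C * norm f)}"
    unfolding K_def J_def by (rule closure_evaluations_subset[OF C])
  then have cK: "compact K"
    using compact_Int_closed[OF compact_functional_ball[of C], of K] by (simp add: K_def Int_absorb1)
  have "inj J" by (auto simp: inj_def J_def fun_eq_iff intro: eq_if_all_functionals_eq)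
  then have invJ: "inv J (J a) = a" for a by simp
  have "continuous_map (top_of_set K) (weak_topology_on UNIV) (inv J)"
  proof (rule continuous_map_weak_topology_on)
    fix \<phi> :: "'a \<Rightarrow> real" assume "bounded_linear_on UNIV \<phi>"
    then have bl: "bounded_linear \<phi>" by (simp add: bounded_linear_on_UNIV)
    have "continuous_on K (\<lambda>z. z (Blinfun \<phi>))"
      by (rule continuous_on_subset[OF continuous_on_product_coordinates]) simp
    moreover have "(\<phi> \<circ> inv J) z = z (Blinfun \<phi>)" if zK: "z \<in> K" for z
    proof -
      obtain a where "z = J a" using cl zK by (auto simp: K_def)
      then show ?thesis by (simp add: invJ) (simp add: J_def bounded_linear_Blinfun_apply[OF bl])
    qed
    ultimately have "continuous_on K (\<phi> \<circ> inv J)" by (simp cong: continuous_on_cong)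
    then show "continuous_map (top_of_set K) euclideanreal (\<phi> \<circ> inv J)"
      by (simp add: continuous_map_iff_continuous)
  qed simp
  then have "compactin (weak_topology_on UNIV) (inv J ` K)"
    by (rule image_compactin[rotated]) (simp add: compactin_subtopology cK)
  moreover have "A \<subseteq> inv J ` K"
  proof
    fix a assume "a \<in> A"
    then have "J a \<in> K" unfolding K_def using closure_subset[of "J ` A"] by blast
    then show "a \<in> inv J ` K" by (rule image_eqI[rotated]) (simp add: invJ)
  qed
  ultimately show ?thesis
    by (rule rel_weakly_compact_in_subset_compact[OF Hausdorff_space_weak_topology_on_UNIV])
qed

section \<open>Elements of the bidual that are not evaluations\<close>

lemma functional_vanishing_on_annihilator:
  fixes \<phi> :: "('a::real_normed_vector \<Rightarrow>\<^sub>L real) \<Rightarrow> real"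
  assumes "finite F" "linear \<phi>" "\<And>f. (\<forall>x\<in>F. blinfun_apply f x = 0) \<Longrightarrow> \<phi> f = 0"
  shows "\<exists>u. \<forall>f. \<phi> f = blinfun_apply f u"
  using assms
proof (induction F arbitrary: \<phi> rule: finite_induct)
  case empty
  then show ?case by (intro exI[of _ 0]) (simp add: blinfun.zero_right)
next
  case (insert x F)
  show ?case
  \<comment> \<open>Either \<open>x\<close> adds no new condition to those of \<open>F\<close>, or
    some \<open>v\<close> vanishing on \<open>F\<close> is nonzero at \<open>x\<close> and serves to
    correct the value there.\<close>
  proof (cases "\<forall>f :: 'a \<Rightarrow>\<^sub>L real. (\<forall>y\<in>F. blinfun_apply f y = 0) \<longrightarrow> blinfun_apply f x = 0")
    case True
    show ?thesis
    proof (rule insert.IH[OF insert.prems(1)])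
      fix f :: "'a \<Rightarrow>\<^sub>L real" assume "\<forall>y\<in>F. blinfun_apply f y = 0"
      then have "\<forall>y\<in>insert x F. blinfun_apply f y = 0" using True by blast
      then show "\<phi> f = 0" by (rule insert.prems(2))
    qed
  next
    case False
    then obtain v :: "'a \<Rightarrow>\<^sub>L real" where v: "\<forall>y\<in>F. blinfun_apply v y = 0" "v x \<noteq> 0" by blast
    \<comment> \<open>The multiple of evaluation at \<open>x\<close> that agrees with
      \<open>\<phi>\<close> at \<open>v\<close>.\<close>
    define c where "c = \<phi> v / v x"
    have "\<exists>u. \<forall>f. \<phi> f - c * blinfun_apply f x = blinfun_apply f u"
    proof (rule insert.IH)
      show "linear (\<lambda>f. \<phi> f - c * blinfun_apply f x)"
        using insert.prems(1)
        by (auto simp: linear_iff blinfun.add_left blinfun.scaleR_left algebra_simps)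
      fix f :: "'a \<Rightarrow>\<^sub>L real" assume f: "\<forall>y\<in>F. blinfun_apply f y = 0"
      define g where "g = f - (f x / v x) *\<^sub>R v"
      have "\<forall>y\<in>insert x F. blinfun_apply g y = 0"
        using f v by (auto simp: g_def blinfun.diff_left blinfun.scaleR_left)
      then have "\<phi> g = 0" by (rule insert.prems(2))
      then have "\<phi> f = (f x / v x) * \<phi> v"
        using insert.prems(1) by (simp add: g_def linear_diff linear_scale)
      then show "\<phi> f - c * blinfun_apply f x = 0" by (simp add: c_def)
    qed
    then obtain u where "\<And>f. \<phi> f - c * blinfun_apply f x = blinfun_apply f u" by blast
    then have "\<phi> f = blinfun_apply f (u + c *\<^sub>R x)" for f
      by (simp add: blinfun.add_right blinfun.scaleR_right) (metis diff_add_cancel)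
    then show ?thesis by blast
  qed
qed

text \<open>The canonical image of a Banach space is norm closed: points \<open>u n\<close>
  approximating \<open>z\<close> with error \<open>1 / (n + 1)\<close> would form a Cauchy sequence
  whose limit represents \<open>z\<close>.\<close>

lemma not_evaluation_imp_distance:
  fixes z :: "('a::banach \<Rightarrow>\<^sub>L real) \<Rightarrow> real"
  assumes "\<nexists>u. \<forall>f. z f = blinfun_apply f u"
  obtains \<theta> where "0 < \<theta>" "\<And>u. \<exists>f. \<theta> * norm f < \<bar>z f - blinfun_apply f u\<bar>"
proof (rule ccontr)
  assume "\<not> thesis"
  then have "\<forall>\<theta>>0. \<exists>u. \<forall>f. \<bar>z f - blinfun_apply f u\<bar> \<le> \<theta> * norm f"
    using that by (meson not_le)
  then have "\<exists>u. \<forall>f. \<bar>z f - blinfun_apply f u\<bar> \<le> inverse (real (Suc n)) * norm f" for n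
    by simp
  then obtain u where u: "\<And>n f. \<bar>z f - blinfun_apply f (u n)\<bar> \<le> inverse (real (Suc n)) * norm f"
    by metis
  have d: "dist (u m) (u n) \<le> inverse (real (Suc m)) + inverse (real (Suc n))" for m n
  proof -
    obtain g :: "'a \<Rightarrow>\<^sub>L real" where g: "norm g \<le> 1" "g (u m - u n) = norm (u m - u n)"
      using ex_norming_functional by blast
    have "norm (u m - u n) = g (u m) - g (u n)" using g(2) by (simp add: blinfun.diff_right)
    also have "\<dots> \<le> inverse (real (Suc m)) * norm g + inverse (real (Suc n)) * norm g"
      using u[of g m] u[of g n] by linarith
    also have "\<dots> \<le> inverse (real (Suc m)) * 1 + inverse (real (Suc n)) * 1"
      using g(1) by (intro add_mono mult_left_mono) auto
    finally show ?thesis by (simp add: dist_norm)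
  qed
  have "Cauchy u"
  proof (rule metric_CauchyI)
    fix e :: real assume "0 < e"
    then obtain N where N: "inverse (real (Suc N)) < e / 2" using reals_Archimedean[of "e / 2"] by auto
    have "dist (u m) (u n) < e" if "m \<ge> N" "n \<ge> N" for m n
    proof -
      have "inverse (real (Suc m)) \<le> inverse (real (Suc N))" "inverse (real (Suc n)) \<le> inverse (real (Suc N))"
        using that by (auto intro!: le_imp_inverse_le)
      then show ?thesis using d[of m n] N by linarith
    qed
    then show "\<exists>M. \<forall>m\<ge>M. \<forall>n\<ge>M. dist (u m) (u n) < e" by blast
  qed
  then obtain w where w: "u \<longlonglongrightarrow> w" using Cauchy_convergent convergent_def by blast
  have "z f = blinfun_apply f w" for f
  proof -
    have "(\<lambda>n. blinfun_apply f (u n)) \<longlonglongrightarrow> blinfun_apply f w"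
      by (intro tendsto_intros w)
    moreover have "(\<lambda>n. blinfun_apply f (u n)) \<longlonglongrightarrow> z f"
    proof (rule Lim_transform2[of "\<lambda>_. z f"])
      have "(\<lambda>n. inverse (real (Suc n)) * norm f) \<longlonglongrightarrow> 0 * norm f"
        by (intro tendsto_intros LIMSEQ_inverse_real_of_nat)
      then show "(\<lambda>n. z f - blinfun_apply f (u n)) \<longlonglongrightarrow> 0"
        by (intro Lim_null_comparison[of "\<lambda>n. z f - blinfun_apply f (u n)"]) (use u in auto)
    qed simp
    ultimately show ?thesis using LIMSEQ_unique by blast
  qed
  then show False using assms by blast
qed

text \<open>If \<open>z\<close> were bounded by \<open>\<theta>\<close> on the annihilator of
  \<open>F\<close>, an extension \<open>g\<close> with the same bound would differ from
  \<open>z\<close> by an evaluation, against the distance assumption.\<close>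

lemma annihilating_functional_large:
  fixes z :: "('a::banach \<Rightarrow>\<^sub>L real) \<Rightarrow> real"
  assumes z: "linear z" and \<theta>: "0 < \<theta>" "\<And>u. \<exists>f. \<theta> * norm f < \<bar>z f - blinfun_apply f u\<bar>"
    and F: "finite F"
  obtains f where "norm f \<le> 1" "\<And>x. x \<in> F \<Longrightarrow> blinfun_apply f x = 0" "\<theta> < z f"
proof -
  define M where "M = {f :: 'a \<Rightarrow>\<^sub>L real. \<forall>x\<in>F. blinfun_apply f x = 0}"
  have M: "subspace M" unfolding M_def
    by (auto simp: subspace_def blinfun.add_left blinfun.scaleR_left)
  have "\<exists>f\<in>M. \<theta> * norm f < \<bar>z f\<bar>"
  proof (rule ccontr)
    assume "\<not> ?thesis"
    then have "\<And>f. f \<in> M \<Longrightarrow> \<bar>z f\<bar> \<le> \<theta> * norm f" by (meson not_le)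
    then obtain g where g: "linear g" "\<And>f. \<bar>g f\<bar> \<le> \<theta> * norm f" "\<And>f. f \<in> M \<Longrightarrow> g f = z f"
      using ex_linear_extension[OF M z less_imp_le[OF \<theta>(1)]] by blast
    have "\<exists>u. \<forall>f. z f - g f = blinfun_apply f u"
      using F by (rule functional_vanishing_on_annihilator)
        (use z g in \<open>auto simp: linear_compose_sub M_def\<close>)
    then obtain u where "\<And>f. z f - blinfun_apply f u = g f" by (metis diff_diff_eq2 add_diff_cancel_left')
    then show False using \<theta>(2)[of u] g(2) by (metis not_le)
  qed
  then obtain f where f: "f \<in> M" "\<theta> * norm f < \<bar>z f\<bar>" by blast
  have "f \<noteq> 0" using f(2) linear_0[OF z] by auto
  \<comment> \<open>Division by the norm puts \<open>g\<close> in the unit ball, and the sign of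
    \<open>z f\<close> makes \<open>z g\<close> positive.\<close>
  define g where "g = (sgn (z f) / norm f) *\<^sub>R f"
  show thesis
  proof
    show "norm g \<le> 1" using \<open>f \<noteq> 0\<close> by (simp add: g_def abs_sgn_eq)
    show "blinfun_apply g x = 0" if "x \<in> F" for x
      using f(1) that by (simp add: g_def M_def blinfun.scaleR_left)
    have "z g = \<bar>z f\<bar> / norm f"
      using z by (simp add: g_def linear_scale abs_sgn mult.commute)
    then show "\<theta> < z g" using f(2) \<open>f \<noteq> 0\<close> by (simp add: pos_less_divide_eq)
  qed
qed

text \<open>Finitely many strict inequalities cut out a weak* neighbourhood of \<open>z\<close>,
  which meets the image of \<open>A\<close>.\<close>

lemma closure_evaluations_approx:
  fixes A :: "'a::real_normed_vector set"
  assumes z: "z \<in> closure ((\<lambda>a (f :: 'a \<Rightarrow>\<^sub>L real). f a) ` A)" and G: "finite G" "\<And>g. g \<in> G \<Longrightarrow> \<theta> < z g"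
  obtains a where "a \<in> A" "\<And>g. g \<in> G \<Longrightarrow> \<theta> < blinfun_apply g a"
proof -
  let ?U = "\<Inter>g\<in>G. {w :: ('a \<Rightarrow>\<^sub>L real) \<Rightarrow> real. \<theta> < w g}"
  have "open ?U"
    using G(1) by (intro open_INT ballI open_Collect_less continuous_on_const continuous_on_product_coordinates)
  moreover have "z \<in> ?U" using G(2) by auto
  ultimately have "(\<lambda>a (f :: 'a \<Rightarrow>\<^sub>L real). f a) ` A \<inter> ?U \<noteq> {}"
    using z unfolding closure_iff_nhds_not_empty by blast
  then show thesis using that by blast
qed

text \<open>Choose alternately: \<open>f n\<close> large at \<open>z\<close> but zero at the earlier
  \<open>x k\<close>, then \<open>x n\<close> in \<open>A\<close> so close to \<open>z\<close> in
  the weak* sense that \<open>f 0, ..., f n\<close> all exceed \<open>\<theta>\<close>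
  there.\<close>

lemma not_rel_weakly_compact_imp_James_sequence:
  fixes A :: "'a::banach set"
  assumes C: "\<And>a. a \<in> A \<Longrightarrow> norm a \<le> C" and A: "\<not> rel_weakly_compact_in UNIV A"
  obtains x :: "nat \<Rightarrow> 'a" and f :: "nat \<Rightarrow> ('a \<Rightarrow>\<^sub>L real)" and \<theta> :: real
  where "0 < \<theta>" "\<And>n. x n \<in> A" "\<And>n. norm (f n) \<le> 1"
    "\<And>k n. k \<le> n \<Longrightarrow> \<theta> < f k (x n)" "\<And>k n. n < k \<Longrightarrow> f k (x n) = 0"
proof -
  let ?J = "\<lambda>a (f :: 'a \<Rightarrow>\<^sub>L real). blinfun_apply f a"
  obtain z where z: "z \<in> closure (?J ` A)" "z \<notin> range ?J"
    using rel_weakly_compact_in_closure_evaluations[of A C] A C by blast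
  have lin: "linear z" using closure_evaluations_subset[OF C] z(1) by auto
  have "\<nexists>u. \<forall>f. z f = blinfun_apply f u" using z(2) by (auto simp: fun_eq_iff)
  then obtain \<theta> where \<theta>: "0 < \<theta>" "\<And>u. \<exists>f. \<theta> * norm f < \<bar>z f - blinfun_apply f u\<bar>"
    using not_evaluation_imp_distance by blast
  \<comment> \<open>Each \<open>r\<close> pairs a functional with a point. The clause
    \<open>\<theta> < z (fst r)\<close> is what lets every later point satisfy the inequality for
    the older functionals.\<close>
  define P where "P s n r \<longleftrightarrow> norm (fst r) \<le> 1 \<and> \<theta> < z (fst r) \<and> snd r \<in> A \<and> \<theta> < blinfun_apply (fst r) (snd r)
     \<and> (\<forall>k<n. blinfun_apply (fst r) (snd (s k)) = 0) \<and> (\<forall>k<n. \<theta> < blinfun_apply (fst (s k)) (snd r))"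
    for s :: "nat \<Rightarrow> ('a \<Rightarrow>\<^sub>L real) \<times> 'a" and n r
  have "\<exists>s. \<forall>n. P s n (s n)"
  proof (rule dependent_wellorder_choice)
    show "P s n r = P t n r" if "\<And>k. k < n \<Longrightarrow> s k = t k" for r s t n
      using that by (auto simp: P_def)
    fix n s assume s: "\<And>k. k < n \<Longrightarrow> P s k (s k)"
    obtain f where f: "norm f \<le> 1" "\<And>x. x \<in> (\<lambda>k. snd (s k)) ` {..<n} \<Longrightarrow> blinfun_apply f x = 0" "\<theta> < z f"
      using annihilating_functional_large[OF lin \<theta>, of "(\<lambda>k. snd (s k)) ` {..<n}"] by blast
    have "\<theta> < z g" if "g \<in> insert f ((\<lambda>k. fst (s k)) ` {..<n})" for g
      using that f(3) s by (auto simp: P_def)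
    then obtain a where a: "a \<in> A" "\<And>g. g \<in> insert f ((\<lambda>k. fst (s k)) ` {..<n}) \<Longrightarrow> \<theta> < blinfun_apply g a"
      using closure_evaluations_approx[OF z(1), of "insert f ((\<lambda>k. fst (s k)) ` {..<n})" \<theta>] by blast
    then have "P s n (f, a)" using f by (auto simp: P_def)
    then show "\<exists>r. P s n r" by blast
  qed
  then obtain s where s: "\<And>n. P s n (s n)" by blast
  show thesis
  proof (rule that[OF \<theta>(1)])
    show "\<theta> < blinfun_apply (fst (s k)) (snd (s n))" if "k \<le> n" for k n
      using s[of n] that by (cases "k = n") (auto simp: P_def)
  qed (use s in \<open>auto simp: P_def\<close>)
qed

text \<open>A weak cluster point \<open>b\<close> has \<open>f k b \<ge> \<theta>\<close> for all
  \<open>k\<close>, whereas each vector in the span of the \<open>x n\<close> is annihilated by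
  almost all \<open>f k\<close>. So \<open>b\<close> has positive distance from that span, and a
  functional that is zero on it but positive at \<open>b\<close> contradicts clustering.\<close>

lemma James_sequence_not_rel_weakly_compact:
  fixes x :: "nat \<Rightarrow> 'a::real_normed_vector" and f :: "nat \<Rightarrow> ('a \<Rightarrow>\<^sub>L real)"
  assumes \<theta>: "0 < \<theta>" and f: "\<And>n. norm (f n) \<le> 1"
    and ge: "\<And>k n. k \<le> n \<Longrightarrow> \<theta> < f k (x n)" and zero: "\<And>k n. n < k \<Longrightarrow> f k (x n) = 0"
  shows "\<not> rel_weakly_compact_in UNIV (range x)"
proof
  assume "rel_weakly_compact_in UNIV (range x)"
  then obtain b where b: "\<And>U N. openin (weak_topology_on UNIV) U \<Longrightarrow> b \<in> U \<Longrightarrow> \<exists>n\<ge>N. x n \<in> U"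
    by (rule rel_weakly_compact_in_cluster_point[of UNIV "range x" x]) auto
  have cp: "\<exists>n\<ge>N. blinfun_apply g (x n) \<in> U" if "open U" "blinfun_apply g b \<in> U" for U N and g :: "'a \<Rightarrow>\<^sub>L real"
  proof -
    have "bounded_linear_on UNIV (blinfun_apply g)"
      by (simp add: bounded_linear_on_UNIV blinfun.bounded_linear_right)
    then show ?thesis using b[OF openin_weak_topology_on[OF _ that(1)], of "blinfun_apply g" N] that(2) by auto
  qed
  have fb: "\<theta> \<le> f k b" for k
  proof (rule ccontr)
    assume "\<not> \<theta> \<le> f k b"
    then obtain n where "n \<ge> k" "f k (x n) < \<theta>" using cp[of "{..<\<theta>}" "f k" k] by auto
    then show False using ge[of k n] by simp
  qed
  \<comment> \<open>In place of the span of the \<open>x n\<close>, this subspace containing it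
    makes membership supply a \<open>k\<close> with \<open>f k y = 0\<close>.\<close>
  define M where "M = {y. \<exists>m. \<forall>k\<ge>m. blinfun_apply (f k) y = 0}"
  have M: "subspace M"
    unfolding subspace_def M_def
  proof (intro conjI ballI allI)
    fix u v assume "u \<in> {y. \<exists>m. \<forall>k\<ge>m. blinfun_apply (f k) y = 0}" "v \<in> {y. \<exists>m. \<forall>k\<ge>m. blinfun_apply (f k) y = 0}"
    then obtain m n where "\<forall>k\<ge>m. blinfun_apply (f k) u = 0" "\<forall>k\<ge>n. blinfun_apply (f k) v = 0" by blast
    then show "u + v \<in> {y. \<exists>m. \<forall>k\<ge>m. blinfun_apply (f k) y = 0}"
      by (auto simp: blinfun.add_right intro!: exI[of _ "max m n"])
  qed (auto simp: blinfun.zero_right blinfun.scaleR_right)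
  have xM: "x n \<in> M" for n using zero by (auto simp: M_def intro!: exI[of _ "Suc n"])
  have "\<theta> \<le> norm (b - y)" if "y \<in> M" for y
  proof -
    obtain k where "f k y = 0" using \<open>y \<in> M\<close> by (auto simp: M_def)
    then have "\<theta> \<le> f k (b - y)" using fb[of k] by (simp add: blinfun.diff_right)
    also have "\<dots> \<le> norm (f k) * norm (b - y)" using norm_blinfun[of "f k" "b - y"] by simp
    also have "\<dots> \<le> 1 * norm (b - y)" using f by (intro mult_right_mono) auto
    finally show ?thesis by simp
  qed
  then obtain g :: "'a \<Rightarrow>\<^sub>L real" where g: "\<And>y. y \<in> M \<Longrightarrow> g y = 0" "0 < g b"
    using ex_separating_functional[OF M \<theta>] by blast
  then show False using cp[of "{0<..}" g 0] xM by auto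
qed

section \<open>Almost Grothendieck operators map balls to almost Grothendieck sets\<close>

text \<open>\<open>Bcontfun\<close> is inverted only on bounded continuous functions; a null
  sequence is one, being bounded and defined on a discrete space.\<close>

lemma apply_bcontfun_null_sequence:
  fixes s :: "nat \<Rightarrow> real"
  assumes "s \<longlonglongrightarrow> 0"
  shows "apply_bcontfun (Bcontfun s) = s"
  using assms
  by (intro Bcontfun_inverse) (auto simp: bcontfun_def intro: convergent_imp_bounded)

lemma apply_c0_op: "weak_star_null f \<Longrightarrow> apply_bcontfun (c0_op f x) n = f n x"
  unfolding c0_op_def by (simp add: apply_bcontfun_null_sequence weak_star_null_def)

lemma bounded_linear_on_coordinate:
  "bounded_linear_on M (\<lambda>y :: nat \<Rightarrow>\<^sub>C real. y n)"
  unfolding bounded_linear_on_def using norm_bounded[of _ n] by (auto intro!: exI[of _ 1] simp flip: real_norm_def)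

lemma Hausdorff_space_weak_topology_on_c0: "Hausdorff_space (weak_topology_on c0_space)"
proof (rule Hausdorff_space_weak_topology_on)
  fix x y :: "nat \<Rightarrow>\<^sub>C real" assume "x \<noteq> y"
  then obtain n where "x n \<noteq> y n" using bcontfun_eqI by blast
  then show "\<exists>\<phi>. bounded_linear_on c0_space \<phi> \<and> \<phi> x \<noteq> \<phi> y"
    using bounded_linear_on_coordinate by blast
qed

text \<open>The duality between \<open>c_0\<close> and \<open>l_1\<close>: the coefficients are the
  values at the unit sequences.\<close>

lemma c0_functional_sums:
  assumes \<phi>: "bounded_linear_on c0_space \<phi>"
  obtains a where "summable (\<lambda>n. \<bar>a n\<bar>)" "\<And>y. y \<in> c0_space \<Longrightarrow> (\<lambda>n. a n * apply_bcontfun y n) sums \<phi> y"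
proof -
  have add: "\<And>x y. x \<in> c0_space \<Longrightarrow> y \<in> c0_space \<Longrightarrow> \<phi> (x + y) = \<phi> x + \<phi> y"
    and scale: "\<And>c x. x \<in> c0_space \<Longrightarrow> \<phi> (c *\<^sub>R x) = c * \<phi> x"
    using \<phi> by (auto simp: bounded_linear_on_def)
  obtain K where K: "\<And>x. x \<in> c0_space \<Longrightarrow> \<bar>\<phi> x\<bar> \<le> K * norm x"
    using \<phi> unfolding bounded_linear_on_def by blast
  \<comment> \<open>Truncation is applied to signs, for summability of the coefficients, and to
    \<open>y\<close>, for convergence of the series to \<open>\<phi> y\<close>.\<close>
  define t where "t N s = Bcontfun (\<lambda>k. if k < N then s k else 0)" for N :: nat and s :: "nat \<Rightarrow> real"
  define e where "e n = Bcontfun (\<lambda>k. if k = n then 1 else 0 :: real)" for n :: nat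
  have lim: "(\<lambda>k. if k < N then s k else 0) \<longlonglongrightarrow> 0" for N and s :: "nat \<Rightarrow> real"
    by (rule tendsto_eventually) (auto simp: eventually_sequentially intro!: exI[of _ N])
  have lim_e: "(\<lambda>k. if k = n then 1 else 0 :: real) \<longlonglongrightarrow> 0" for n
    by (rule tendsto_eventually) (auto simp: eventually_sequentially intro!: exI[of _ "Suc n"])
  have t: "apply_bcontfun (t N s) = (\<lambda>k. if k < N then s k else 0)" for N s
    unfolding t_def by (rule apply_bcontfun_null_sequence[OF lim])
  have e: "apply_bcontfun (e n) = (\<lambda>k. if k = n then 1 else 0)" for n
    unfolding e_def by (rule apply_bcontfun_null_sequence[OF lim_e])
  have t_c0: "t N s \<in> c0_space" for N s using lim by (simp add: c0_space_def t)
  have e_c0: "e n \<in> c0_space" for n using lim_e by (simp add: c0_space_def e)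
  have scale_c0: "c *\<^sub>R x \<in> c0_space" if "x \<in> c0_space" for c x
    using that by (simp add: c0_space_def tendsto_mult_right_zero)
  have \<phi>t: "\<phi> (t N s) = (\<Sum>n<N. \<phi> (e n) * s n)" for N s
  proof (induction N)
    case 0
    have "t 0 s = 0" by (intro bcontfun_eqI) (simp add: t)
    then show ?case using scale[OF t_c0[of 0 s], of 0] by simp
  next
    case (Suc N)
    have "t (Suc N) s = t N s + s N *\<^sub>R e N"
      by (intro bcontfun_eqI) (auto simp: t e less_Suc_eq)
    then show ?case using Suc by (simp add: add scale scale_c0 t_c0 e_c0)
  qed
  show thesis
  proof
    show "summable (\<lambda>n. \<bar>\<phi> (e n)\<bar>)"
    proof (rule summableI_nonneg_bounded[of _ "\<bar>K\<bar>"])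
      fix N
      \<comment> \<open>On the truncated signs, of norm at most 1, \<open>\<phi>\<close> takes the
        partial sum as its value. The bound is the absolute value of \<open>K\<close>, as nothing
        fixes the sign of \<open>K\<close>.\<close>
      let ?s = "\<lambda>n. sgn (\<phi> (e n))"
      have "norm (t N ?s) \<le> 1" by (rule norm_bound) (auto simp: t abs_sgn_eq)
      then have "K * norm (t N ?s) \<le> \<bar>K\<bar> * 1" by (intro mult_mono) auto
      then have "\<phi> (t N ?s) \<le> \<bar>K\<bar>" using K[OF t_c0, of N ?s] by simp
      then show "(\<Sum>n<N. \<bar>\<phi> (e n)\<bar>) \<le> \<bar>K\<bar>" by (simp add: \<phi>t abs_sgn mult.commute)
    qed simp
    fix y :: "nat \<Rightarrow>\<^sub>C real" assume y: "y \<in> c0_space"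
    show "(\<lambda>n. \<phi> (e n) * y n) sums \<phi> y"
      unfolding sums_def
    proof (rule Lim_transform2[of "\<lambda>_. \<phi> y"])
      have "(\<lambda>N. norm (y - t N y)) \<longlonglongrightarrow> 0"
      proof (rule LIMSEQ_I)
        fix r :: real assume "0 < r"
        then obtain M where M: "\<And>n. n \<ge> M \<Longrightarrow> \<bar>y n\<bar> < r / 2"
          using y LIMSEQ_D[of "apply_bcontfun y" 0 "r / 2"] by (simp add: c0_space_def) blast
        have "norm (y - t N y) \<le> r / 2" if "N \<ge> M" for N
        proof (rule norm_bound)
          fix k show "norm (apply_bcontfun (y - t N y) k) \<le> r / 2"
            using M[of k] that \<open>0 < r\<close> by (auto simp: t)
        qed
        then have "norm (norm (y - t N y) - 0) < r" if "N \<ge> M" for N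
          using that \<open>0 < r\<close> by fastforce
        then show "\<exists>M. \<forall>N\<ge>M. norm (norm (y - t N y) - 0) < r" by blast
      qed
      then have lim0: "(\<lambda>N. K * norm (y - t N y)) \<longlonglongrightarrow> 0" by (rule tendsto_mult_right_zero)
      show "(\<lambda>N. \<phi> y - (\<Sum>n<N. \<phi> (e n) * y n)) \<longlonglongrightarrow> 0"
      proof (rule Lim_null_comparison[OF _ lim0], rule always_eventually, rule allI)
        fix N
        have d: "y - t N y \<in> c0_space"
          using y t_c0[of N y] tendsto_diff[of "apply_bcontfun y" 0 sequentially "apply_bcontfun (t N y)" 0]
          by (simp add: c0_space_def)
        have "\<phi> y = \<phi> (y - t N y) + \<phi> (t N y)"
          using add[OF d t_c0[of N y]] by simp
        then show "norm (\<phi> y - (\<Sum>n<N. \<phi> (e n) * y n)) \<le> K * norm (y - t N y)"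
          using K[OF d] by (simp add: \<phi>t)
      qed
    qed simp
  qed
qed

text \<open>The map \<open>h\<close> extends \<open>c0_op g\<close> to the unit ball of the bidual,
  where the hypothesis says that its values are null sequences. It is weak*-to-weak continuous since
  composing it with a functional on \<open>c_0\<close> gives a series that converges uniformly on
  that ball.\<close>

lemma rel_weakly_compact_in_c0_image:
  fixes g :: "nat \<Rightarrow> ('x::real_normed_vector \<Rightarrow>\<^sub>L real)"
  assumes g: "\<And>\<Phi> :: ('x \<Rightarrow>\<^sub>L real) \<Rightarrow> real. bounded_linear \<Phi> \<Longrightarrow> (\<lambda>n. \<Phi> (g n)) \<longlonglongrightarrow> 0"
    and C: "\<And>n. norm (g n) \<le> C"
  shows "rel_weakly_compact_in c0_space (c0_op g ` cball 0 1)"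
proof -
  let ?Z = "{z :: ('x \<Rightarrow>\<^sub>L real) \<Rightarrow> real. linear z \<and> (\<forall>f. \<bar>z f\<bar> \<le> 1 * norm f)}"
  define h where "h z = Bcontfun (\<lambda>n. z (g n))" for z :: "('x \<Rightarrow>\<^sub>L real) \<Rightarrow> real"
  have null: "(\<lambda>n. z (g n)) \<longlonglongrightarrow> 0" if "z \<in> ?Z" for z
    using that by (intro g) (auto simp: bounded_linear_def bounded_linear_axioms_def intro!: exI[of _ 1])
  then have h: "apply_bcontfun (h z) = (\<lambda>n. z (g n))" if "z \<in> ?Z" for z
    unfolding h_def by (rule apply_bcontfun_null_sequence) (use that in blast)
  have h_c0: "h z \<in> c0_space" if "z \<in> ?Z" for z
    unfolding c0_space_def using null[OF that] h[OF that] by simp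
  have "continuous_map (top_of_set ?Z) (weak_topology_on c0_space) h"
  proof (rule continuous_map_weak_topology_on)
    show "h \<in> topspace (top_of_set ?Z) \<rightarrow> c0_space" using h_c0 by simp
    fix \<phi> assume "bounded_linear_on c0_space \<phi>"
    then obtain a where a: "summable (\<lambda>n. \<bar>a n\<bar>)"
      "\<And>y. y \<in> c0_space \<Longrightarrow> (\<lambda>n. a n * apply_bcontfun y n) sums \<phi> y"
      using c0_functional_sums by blast
    have ul: "uniform_limit ?Z (\<lambda>n z. \<Sum>i<n. a i * z (g i)) (\<lambda>z. \<Sum>i. a i * z (g i)) sequentially"
    proof (rule Weierstrass_m_test)
      show "summable (\<lambda>n. \<bar>a n\<bar> * C)" using a(1) by (rule summable_mult2)
      fix n z assume "z \<in> ?Z"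
      then have "\<bar>z (g n)\<bar> \<le> norm (g n)" by auto
      also have "\<dots> \<le> C" by (rule C)
      finally show "norm (a n * z (g n)) \<le> \<bar>a n\<bar> * C"
        by (simp add: abs_mult mult_left_mono)
    qed
    have cont: "continuous_on ?Z (\<lambda>z. \<Sum>i. a i * z (g i))"
      by (rule uniform_limit_theorem[OF always_eventually ul])
        (auto intro!: continuous_intros continuous_on_subset[OF continuous_on_product_coordinates])
    have eq: "(\<phi> \<circ> h) z = (\<Sum>i. a i * z (g i))" if "z \<in> ?Z" for z
      using sums_unique[OF a(2)[OF h_c0[OF that]]] h[OF that] by simp
    have "continuous_on ?Z (\<phi> \<circ> h)"
      by (rule continuous_on_eq[OF cont eq[symmetric]])
    then show "continuous_map (top_of_set ?Z) euclideanreal (\<phi> \<circ> h)"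
      by (simp add: continuous_map_iff_continuous)
  qed
  then have "compactin (weak_topology_on c0_space) (h ` ?Z)"
    by (rule image_compactin[rotated]) (use compact_functional_ball[of 1] in \<open>simp add: compactin_subtopology\<close>)
  moreover have "c0_op g ` cball 0 1 \<subseteq> h ` ?Z"
  proof
    fix y assume "y \<in> c0_op g ` cball 0 1"
    then obtain x where x: "norm x \<le> 1" "y = c0_op g x" by auto
    have "\<bar>blinfun_apply f x\<bar> \<le> norm f" for f :: "'x \<Rightarrow>\<^sub>L real"
      using norm_blinfun[of f x] mult_left_mono[OF x(1), of "norm f"] by simp
    then have "(\<lambda>f. blinfun_apply f x) \<in> ?Z"
      using blinfun.bounded_linear_left bounded_linear.linear by auto
    moreover have "y = h (\<lambda>f. blinfun_apply f x)" by (simp add: x(2) h_def c0_op_def)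
    ultimately show "y \<in> h ` ?Z" by blast
  qed
  ultimately show ?thesis
    by (rule rel_weakly_compact_in_subset_compact[OF Hausdorff_space_weak_topology_on_c0])
qed

text \<open>Pulling \<open>f\<close> back along \<open>T\<close> gives a bounded weakly null
  sequence, whose operator into \<open>c_0\<close> is that of \<open>f\<close> composed with
  \<open>T\<close>.\<close>

lemma almost_grothendieck_op_image_ball:
  fixes T :: "'x::real_normed_vector \<Rightarrow>\<^sub>L 'e::banach_lattice"
  assumes T: "almost_grothendieck_op T"
  shows "almost_grothendieck_set (blinfun_apply T ` cball 0 1)"
  unfolding almost_grothendieck_set_def
proof (intro allI impI)
  fix f :: "nat \<Rightarrow> ('e \<Rightarrow>\<^sub>L real)" assume f: "weak_star_null f \<and> disjoint_seq f"
  then obtain C where C: "0 < C" "\<And>n. norm (f n) \<le> C" using weak_star_null_bounded by blast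
  have "norm (f n o\<^sub>L T) \<le> C * norm T" for n
    using norm_blinfun_compose[of "f n" T] mult_right_mono[OF C(2), of "norm T" n] by simp
  moreover have "(\<lambda>n. \<Phi> (f n o\<^sub>L T)) \<longlonglongrightarrow> 0" if "bounded_linear \<Phi>" for \<Phi> :: "('x \<Rightarrow>\<^sub>L real) \<Rightarrow> real"
    using T f that by (auto simp: almost_grothendieck_op_def)
  ultimately have "rel_weakly_compact_in c0_space (c0_op (\<lambda>n. f n o\<^sub>L T) ` cball 0 1)"
    by (intro rel_weakly_compact_in_c0_image)
  moreover have "c0_op (\<lambda>n. f n o\<^sub>L T) x = c0_op f (T x)" for x by (simp add: c0_op_def)
  ultimately show "rel_weakly_compact_in c0_space (c0_op f ` blinfun_apply T ` cball 0 1)"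
    by (simp add: image_image)
qed

section \<open>Operators on the sequence space l1\<close>

text \<open>Absolute convergence defines the operator that sends the unit vectors to the
  \<open>a n\<close>, which places a bounded sequence in the image of the unit ball.\<close>

lemma ex_l1_combination:
  fixes a :: "nat \<Rightarrow> 'e::banach"
  assumes C: "\<And>n. norm (a n) \<le> C"
  obtains T :: "l1 \<Rightarrow>\<^sub>L 'e" where "\<And>x. (\<lambda>k. l1_apply x k *\<^sub>R a k) sums T x"
proof -
  define T where "T x = (\<Sum>k. l1_apply x k *\<^sub>R a k)" for x
  have b: "norm (l1_apply x k *\<^sub>R a k) \<le> \<bar>l1_apply x k\<bar> * C" for x k
    using mult_left_mono[OF C[of k], of "\<bar>l1_apply x k\<bar>"] by simp
  have sC: "summable (\<lambda>k. \<bar>l1_apply x k\<bar> * C)" for x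
    using l1_apply[of x] by (intro summable_mult2) simp
  have sn: "summable (\<lambda>k. norm (l1_apply x k *\<^sub>R a k))" for x
    by (rule summable_comparison_test'[OF sC[of x]]) (use b[of x] in simp)
  have T: "(\<lambda>k. l1_apply x k *\<^sub>R a k) sums T x" for x
    unfolding T_def by (rule summable_sums[OF summable_norm_cancel[OF sn]])
  have "bounded_linear T"
  proof (rule bounded_linear_intro)
    fix x y
    have "(\<lambda>k. l1_apply (x + y) k *\<^sub>R a k) sums (T x + T y)"
      using sums_add[OF T[of x] T[of y]] by (simp add: plus_l1.rep_eq scaleR_add_left)
    then show "T (x + y) = T x + T y" using T[of "x + y"] sums_unique2 by blast
    fix c
    have "(\<lambda>k. l1_apply (c *\<^sub>R x) k *\<^sub>R a k) sums (c *\<^sub>R T x)"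
      using sums_scaleR_right[OF T[of x], of c] by (simp add: scaleR_l1.rep_eq)
    then show "T (c *\<^sub>R x) = c *\<^sub>R T x" using T[of "c *\<^sub>R x"] sums_unique2 by blast
    have "norm (T x) \<le> (\<Sum>k. norm (l1_apply x k *\<^sub>R a k))"
      unfolding T_def by (rule summable_norm[OF sn])
    also have "\<dots> \<le> (\<Sum>k. \<bar>l1_apply x k\<bar> * C)"
      by (rule suminf_le[OF b sn sC])
    also have "\<dots> = norm x * C"
      using l1_apply[of x] by (simp add: norm_l1.rep_eq suminf_mult2)
    finally show "norm (T x) \<le> norm x * C" .
  qed
  then show thesis using that[of "Blinfun T"] T by (simp add: bounded_linear_Blinfun_apply)
qed

section \<open>Unit vectors and coordinate projections of \<open>l_1\<close>\<close>

lift_definition l1_unit :: "nat \<Rightarrow> l1" is "\<lambda>k n. if n = k then 1 else 0"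
  by (rule summable_finite[of "{k}" for k]) auto

lemma norm_l1_unit: "norm (l1_unit k) = 1"
proof -
  have "(\<lambda>n. \<bar>l1_apply (l1_unit k) n\<bar>) sums \<bar>l1_apply (l1_unit k) k\<bar>"
    by (rule sums_finite[of "{k}", THEN sums_cong[THEN iffD1, rotated], simplified]) (auto simp: l1_unit.rep_eq)
  then show ?thesis by (simp add: norm_l1.rep_eq sums_iff l1_unit.rep_eq)
qed

lift_definition l1_restrict_fun :: "nat set \<Rightarrow> l1 \<Rightarrow> l1" is "\<lambda>A f n. if n \<in> A then f n else 0"
  by (rule summable_comparison_test') auto

text \<open>The \<open>l_1\<close> norm is additive over disjoint supports. With
  \<open>B = {}\<close> this gives contractivity; for general \<open>B\<close> it underlies the
  superadditivity of \<open>variation\<close>.\<close>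

lemma norm_l1_restrict_fun_disjoint:
  assumes "A \<inter> B = {}"
  shows "norm (l1_restrict_fun A x) + norm (l1_restrict_fun B x) \<le> norm x"
proof -
  have s: "summable (\<lambda>n. \<bar>l1_apply y n\<bar>)" for y using l1_apply[of y] by simp
  have "norm (l1_restrict_fun A x) + norm (l1_restrict_fun B x)
      = (\<Sum>n. \<bar>l1_apply (l1_restrict_fun A x) n\<bar> + \<bar>l1_apply (l1_restrict_fun B x) n\<bar>)"
    unfolding norm_l1.rep_eq by (rule suminf_add[OF s s])
  also have "\<dots> \<le> norm x"
    unfolding norm_l1.rep_eq
    by (rule suminf_le[OF _ summable_add[OF s s] s]) (use assms in \<open>auto simp: l1_restrict_fun.rep_eq\<close>)
  finally show ?thesis .
qed

lemma l1_apply_eqI: "(\<And>n. l1_apply x n = l1_apply y n) \<Longrightarrow> x = y"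
  by (metis l1_apply_inject ext)

text \<open>Composing a functional with this projection multiplies the representing bounded sequence
  by the indicator of \<open>A\<close>.\<close>

lift_definition l1_restrict :: "nat set \<Rightarrow> l1 \<Rightarrow>\<^sub>L l1" is l1_restrict_fun
proof (rule bounded_linear_intro[where K = 1])
  fix A x y
  show "l1_restrict_fun A (x + y) = l1_restrict_fun A x + l1_restrict_fun A y"
    by (rule l1_apply_eqI) (simp add: l1_restrict_fun.rep_eq plus_l1.rep_eq)
  show "l1_restrict_fun A (c *\<^sub>R x) = c *\<^sub>R l1_restrict_fun A x" for c
    by (rule l1_apply_eqI) (simp add: l1_restrict_fun.rep_eq scaleR_l1.rep_eq)
  show "norm (l1_restrict_fun A x) \<le> norm x * 1"
    using norm_l1_restrict_fun_disjoint[OF Int_empty_right, of A x] norm_ge_zero[of "l1_restrict_fun {} x"] by linarith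
qed

lemma l1_apply_restrict: "l1_apply (l1_restrict A x) n = (if n \<in> A then l1_apply x n else 0)"
  by (simp add: l1_restrict.rep_eq l1_restrict_fun.rep_eq)

lemma norm_l1_restrict_disjoint: "A \<inter> B = {} \<Longrightarrow> norm (l1_restrict A x) + norm (l1_restrict B x) \<le> norm x"
  by (simp add: l1_restrict.rep_eq norm_l1_restrict_fun_disjoint)

lemma l1_restrict_restrict: "l1_restrict A (l1_restrict B x) = l1_restrict (A \<inter> B) x"
  by (rule l1_apply_eqI) (simp add: l1_apply_restrict)

lemma l1_restrict_Un: "A \<inter> B = {} \<Longrightarrow> l1_restrict (A \<union> B) x = l1_restrict A x + l1_restrict B x"
  by (rule l1_apply_eqI) (auto simp: l1_apply_restrict plus_l1.rep_eq)

lemma l1_restrict_UNIV: "l1_restrict UNIV x = x"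
  by (rule l1_apply_eqI) (simp add: l1_apply_restrict)

lemma norm_l1_restrict: "norm (l1_restrict A x) \<le> norm x"
  using norm_l1_restrict_disjoint[OF Int_empty_right, of A x] norm_ge_zero[of "l1_restrict {} x"] by linarith

lemma norm_compose_l1_restrict:
  fixes g :: "l1 \<Rightarrow>\<^sub>L real"
  assumes "norm g \<le> 1"
  shows "norm (g o\<^sub>L l1_restrict A) \<le> 1"
proof (rule norm_blinfun_bound)
  fix x
  have "norm (g (l1_restrict A x)) \<le> norm g * norm (l1_restrict A x)" by (rule norm_blinfun)
  also have "\<dots> \<le> 1 * norm x" using assms by (intro mult_mono norm_l1_restrict) auto
  finally show "norm ((g o\<^sub>L l1_restrict A) x) \<le> 1 * norm x" by simp
qed simp

text \<open>The total variation of the finitely additive measure on \<open>\<nat>\<close> that represents \<open>\<Phi>\<close>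
  on \<open>\<ell>\<^sub>1' = \<ell>\<^sub>\<infinity>\<close>.\<close>

definition variation :: "((l1 \<Rightarrow>\<^sub>L real) \<Rightarrow> real) \<Rightarrow> nat set \<Rightarrow> real" where
  "variation \<Phi> A = (SUP g\<in>{g. norm g \<le> 1}. \<Phi> (g o\<^sub>L l1_restrict A))"

context
  fixes \<Phi> :: "(l1 \<Rightarrow>\<^sub>L real) \<Rightarrow> real"
  assumes \<Phi>: "bounded_linear \<Phi>"
begin

interpretation \<Phi>: bounded_linear \<Phi> by (rule \<Phi>)

lemma variation_upper:
  assumes "norm g \<le> 1"
  shows "\<Phi> (g o\<^sub>L l1_restrict A) \<le> variation \<Phi> A"
  unfolding variation_def
proof (rule cSUP_upper)
  obtain K where K: "K > 0" "\<And>f. norm (\<Phi> f) \<le> norm f * K" using \<Phi>.pos_bounded by blast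
  show "bdd_above ((\<lambda>g. \<Phi> (g o\<^sub>L l1_restrict A)) ` {g. norm g \<le> 1})"
  proof (rule bdd_aboveI2)
    fix g :: "l1 \<Rightarrow>\<^sub>L real" assume "g \<in> {g. norm g \<le> 1}"
    then have "norm (g o\<^sub>L l1_restrict A) * K \<le> 1 * K"
      using K(1) by (intro mult_right_mono norm_compose_l1_restrict) auto
    then show "\<Phi> (g o\<^sub>L l1_restrict A) \<le> K" using K(2)[of "g o\<^sub>L l1_restrict A"] by simp
  qed
qed (use assms in simp)

lemma variation_least:
  "(\<And>g. norm g \<le> 1 \<Longrightarrow> \<Phi> (g o\<^sub>L l1_restrict A) \<le> b) \<Longrightarrow> variation \<Phi> A \<le> b"
  unfolding variation_def by (intro cSUP_least) (auto intro: exI[of _ 0])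

lemma variation_mono:
  assumes "A \<subseteq> B"
  shows "variation \<Phi> A \<le> variation \<Phi> B"
proof (rule variation_least)
  fix g :: "l1 \<Rightarrow>\<^sub>L real" assume g: "norm g \<le> 1"
  have "g o\<^sub>L l1_restrict A = (g o\<^sub>L l1_restrict A) o\<^sub>L l1_restrict B"
    by (rule blinfun_eqI) (use assms in \<open>simp add: l1_restrict_restrict Int_absorb2\<close>)
  then show "\<Phi> (g o\<^sub>L l1_restrict A) \<le> variation \<Phi> B"
    using variation_upper[OF norm_compose_l1_restrict[OF g], of A B] by simp
qed

lemma variation_subadditive: "variation \<Phi> (A \<union> B) \<le> variation \<Phi> A + variation \<Phi> B"
proof (rule variation_least)
  fix g :: "l1 \<Rightarrow>\<^sub>L real" assume g: "norm g \<le> 1"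
  have "g o\<^sub>L l1_restrict (A \<union> B) = (g o\<^sub>L l1_restrict A) + (g o\<^sub>L l1_restrict (B - A))"
    using l1_restrict_Un[of A "B - A"] by (intro blinfun_eqI) (simp add: blinfun.add_left blinfun.add_right)
  then have "\<Phi> (g o\<^sub>L l1_restrict (A \<union> B)) \<le> variation \<Phi> A + variation \<Phi> (B - A)"
    using variation_upper[OF g, of A] variation_upper[OF g, of "B - A"] by (simp add: \<Phi>.add)
  also have "variation \<Phi> (B - A) \<le> variation \<Phi> B" by (rule variation_mono) auto
  finally show "\<Phi> (g o\<^sub>L l1_restrict (A \<union> B)) \<le> variation \<Phi> A + variation \<Phi> B" by simp
qed

text \<open>Functionals of norm at most 1, cut to disjoint sets, glue to one of norm at most 1,
  which competes in the supremum for the union.\<close>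

lemma variation_superadditive:
  assumes "A \<inter> B = {}"
  shows "variation \<Phi> A + variation \<Phi> B \<le> variation \<Phi> (A \<union> B)"
proof -
  have *: "\<Phi> (g o\<^sub>L l1_restrict A) + \<Phi> (h o\<^sub>L l1_restrict B) \<le> variation \<Phi> (A \<union> B)"
    if g: "norm g \<le> 1" and h: "norm h \<le> 1" for g h
  proof -
    define w where "w = (g o\<^sub>L l1_restrict A) + (h o\<^sub>L l1_restrict B)"
    have "norm w \<le> 1"
    proof (rule norm_blinfun_bound)
      fix x
      have "norm (g (l1_restrict A x)) \<le> 1 * norm (l1_restrict A x)"
        using norm_blinfun[of g] g mult_right_mono[OF g, of "norm (l1_restrict A x)"] order_trans by auto
      moreover have "norm (h (l1_restrict B x)) \<le> 1 * norm (l1_restrict B x)"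
        using norm_blinfun[of h] h mult_right_mono[OF h, of "norm (l1_restrict B x)"] order_trans by auto
      ultimately show "norm (w x) \<le> 1 * norm x"
        using norm_l1_restrict_disjoint[OF assms, of x] by (simp add: w_def blinfun.add_left)
    qed simp
    moreover have "w o\<^sub>L l1_restrict (A \<union> B) = w"
      by (rule blinfun_eqI) (simp add: w_def blinfun.add_left l1_restrict_restrict Int_absorb1 Int_absorb2)
    ultimately show ?thesis
      using variation_upper[of w "A \<union> B"] by (simp add: w_def \<Phi>.add)
  qed
  have "variation \<Phi> B \<le> variation \<Phi> (A \<union> B) - \<Phi> (g o\<^sub>L l1_restrict A)" if "norm g \<le> 1" for g
    using *[OF that] by (intro variation_least) (simp add: algebra_simps)
  then have "variation \<Phi> A \<le> variation \<Phi> (A \<union> B) - variation \<Phi> B"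
    by (intro variation_least) (simp add: algebra_simps)
  then show ?thesis by simp
qed

text \<open>Split \<open>r\<close> along \<open>A\<close>; scaling it by \<open>1 / C\<close> and by
  \<open>- (1 / C)\<close> into the unit ball bounds the part on \<open>A\<close> from both
  sides.\<close>

lemma functional_le_variation:
  assumes C: "0 < C" "norm r \<le> C"
  shows "\<bar>\<Phi> r\<bar> \<le> C * variation \<Phi> A + \<bar>\<Phi> (r o\<^sub>L l1_restrict (- A))\<bar>"
proof -
  have r: "r = (r o\<^sub>L l1_restrict A) + (r o\<^sub>L l1_restrict (- A))"
    using l1_restrict_Un[of A "- A"]
    by (intro blinfun_eqI) (simp add: blinfun.add_left l1_restrict_UNIV flip: blinfun.add_right)
  have *: "\<Phi> ((c *\<^sub>R r) o\<^sub>L l1_restrict A) \<le> variation \<Phi> A" if "\<bar>c\<bar> = 1 / C" for c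
  proof (rule variation_upper)
    show "norm (c *\<^sub>R r) \<le> 1" unfolding norm_scaleR that using C by simp
  qed
  have c: "(c *\<^sub>R r) o\<^sub>L l1_restrict A = c *\<^sub>R (r o\<^sub>L l1_restrict A)" for c
    by (rule blinfun_eqI) (simp add: blinfun.scaleR_left)
  have "c * \<Phi> (r o\<^sub>L l1_restrict A) \<le> variation \<Phi> A" if "\<bar>c\<bar> = 1 / C" for c
    using *[OF that] by (simp only: c \<Phi>.scaleR real_scaleR_def)
  from this[of "1 / C"] this[of "- (1 / C)"] have "\<bar>\<Phi> (r o\<^sub>L l1_restrict A)\<bar> \<le> C * variation \<Phi> A"
    using C(1) by (simp add: abs_le_iff field_simps)
  moreover have "\<Phi> r = \<Phi> (r o\<^sub>L l1_restrict A) + \<Phi> (r o\<^sub>L l1_restrict (- A))"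
    by (subst r) (rule \<Phi>.add)
  ultimately show ?thesis by linarith
qed

end

text \<open>A finitely additive form of \<open>\<mu> (limsup A) \<ge> limsup (\<mu> A)\<close>: tails of the union are
  replaced by finite unions that almost exhaust the measure of the tail.\<close>

lemma finitely_additive_limsup:
  fixes \<mu> :: "'k set \<Rightarrow> real" and A :: "nat \<Rightarrow> 'k set"
  assumes mono: "\<And>A B. A \<subseteq> B \<Longrightarrow> \<mu> A \<le> \<mu> B"
    and sub: "\<And>A B. \<mu> (A \<union> B) \<le> \<mu> A + \<mu> B"
    and super: "\<And>A B. A \<inter> B = {} \<Longrightarrow> \<mu> A + \<mu> B \<le> \<mu> (A \<union> B)"
    and \<delta>: "0 < \<delta>" "\<And>n. \<delta> \<le> \<mu> (A n)"
  obtains N :: "nat \<Rightarrow> nat" and k :: "nat \<Rightarrow> 'k" where "\<And>i j. i \<le> j \<Longrightarrow> \<exists>m\<in>{i..N i}. k j \<in> A m"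
proof -
  define B where "B i n = (\<Union>m\<in>{i..n}. A m)" for i n
  \<comment> \<open>Geometric losses: their partial sums stay below \<open>\<delta> / 2\<close>, so
    the finite intersections formed below keep positive measure.\<close>
  define \<epsilon> where "\<epsilon> i = \<delta> / 2 * (1 / 2) ^ Suc i" for i
  have "\<exists>n\<ge>i. \<forall>m\<ge>n. \<mu> (B i m) \<le> \<mu> (B i n) + \<epsilon> i" for i
  proof -
    have bdd: "bdd_above (range (\<lambda>n. \<mu> (B i n)))" by (rule bdd_aboveI2[of _ _ "\<mu> UNIV"]) (auto intro: mono)
    have "0 < \<epsilon> i" using \<delta>(1) by (simp add: \<epsilon>_def)
    then obtain n where n: "(SUP n. \<mu> (B i n)) - \<epsilon> i < \<mu> (B i n)"
      using less_cSUP_iff[OF _ bdd, of "(SUP n. \<mu> (B i n)) - \<epsilon> i"] by auto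
    \<comment> \<open>Passing to \<open>max i n\<close> makes the union contain
      \<open>A i\<close>.\<close>
    have "\<mu> (B i n) \<le> \<mu> (B i (max i n))" by (rule mono) (auto simp: B_def)
    moreover have "\<mu> (B i m) \<le> (SUP n. \<mu> (B i n))" for m by (rule cSUP_upper[OF _ bdd]) simp
    ultimately have "\<mu> (B i m) \<le> \<mu> (B i (max i n)) + \<epsilon> i" for m using n by (smt (verit))
    then show ?thesis by (intro exI[of _ "max i n"]) auto
  qed
  then obtain N where N: "\<And>i. i \<le> N i" "\<And>i m. N i \<le> m \<Longrightarrow> \<mu> (B i m) \<le> \<mu> (B i (N i)) + \<epsilon> i" by metis
  define D where "D i = B i (N i)" for i
  \<comment> \<open>Both sets lie in a finite union that starts at index \<open>i\<close>, in which
    \<open>D i\<close> has all but \<open>\<epsilon> i\<close> of the measure.\<close>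
  have diff: "\<mu> (D j - D i) \<le> \<epsilon> i" if "i \<le> j" for i j
  proof -
    have "\<mu> (D i) + \<mu> (D j - D i) \<le> \<mu> (D i \<union> (D j - D i))" by (rule super) auto
    also have "\<dots> \<le> \<mu> (B i (max (N i) (N j)))"
      by (rule mono) (use that in \<open>fastforce simp: D_def B_def le_max_iff_disj\<close>)
    also have "\<dots> \<le> \<mu> (D i) + \<epsilon> i" unfolding D_def by (rule N(2)) simp
    finally show ?thesis by simp
  qed
  \<comment> \<open>Each further intersection with some \<open>D i\<close> costs at most
    \<open>\<epsilon> i\<close>.\<close>
  have inter: "\<mu> (D j) \<le> \<mu> (D j \<inter> (\<Inter>i<l. D i)) + (\<Sum>i<l. \<epsilon> i)" if "l \<le> j" for j l
    using that
  proof (induction l)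
    case (Suc l)
    have "\<mu> (D j \<inter> (\<Inter>i<l. D i)) \<le> \<mu> ((D j \<inter> (\<Inter>i<Suc l. D i)) \<union> (D j - D l))"
      by (rule mono) (auto simp: lessThan_Suc)
    also have "\<dots> \<le> \<mu> (D j \<inter> (\<Inter>i<Suc l. D i)) + \<mu> (D j - D l)" by (rule sub)
    finally show ?case using Suc diff[of l j] by simp
  qed simp
  have "D j \<inter> (\<Inter>i<j. D i) \<noteq> {}" for j
  proof
    assume "D j \<inter> (\<Inter>i<j. D i) = {}"
    then have "\<mu> (D j) \<le> \<mu> {} + (\<Sum>i<j. \<epsilon> i)" using inter[of j j] by simp
    moreover have "\<mu> {} \<le> 0" using super[of "{}" "{}"] by simp
    moreover have "\<delta> \<le> \<mu> (D j)"
      using \<delta>(2)[of j] mono[of "A j" "D j"] N(1)[of j] by (force simp: D_def B_def)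
    moreover have "(\<Sum>i<j. \<epsilon> i) = \<delta> / 2 * (1 - (1 / 2) ^ j)"
      by (induction j) (auto simp: \<epsilon>_def algebra_simps)
    moreover have "\<delta> / 2 * (1 - (1 / 2) ^ j) \<le> \<delta> / 2 * 1" using \<delta>(1) by (intro mult_left_mono) auto
    ultimately show False using \<delta>(1) by linarith
  qed
  then have "\<exists>k. k \<in> D j \<inter> (\<Inter>i<j. D i)" for j by blast
  then obtain k where k: "\<And>j. k j \<in> D j \<inter> (\<Inter>i<j. D i)" by metis
  show thesis
  proof (rule that)
    fix i j :: nat assume "i \<le> j"
    then have "k j \<in> D i" using k[of j] by (cases "i = j") auto
    then show "\<exists>m\<in>{i..N i}. k j \<in> A m" by (auto simp: D_def B_def)
  qed
qed

text \<open>As an element of \<open>l_infinity\<close>, \<open>f n o T\<close> has the coordinates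
  \<open>f n (a k)\<close>, so a failure of weak convergence is visible on the sets where these are
  large.\<close>

lemma almost_grothendieck_set_imp_op:
  fixes T :: "l1 \<Rightarrow>\<^sub>L 'e::banach_lattice"
  assumes A: "almost_grothendieck_set A" "\<And>n. a n \<in> A"
    and T: "\<And>x. (\<lambda>k. l1_apply x k *\<^sub>R a k) sums T x"
  shows "almost_grothendieck_op T"
  unfolding almost_grothendieck_op_def
proof (intro allI impI, rule ccontr)
  fix f :: "nat \<Rightarrow> ('e \<Rightarrow>\<^sub>L real)" and \<Phi> :: "(l1 \<Rightarrow>\<^sub>L real) \<Rightarrow> real"
  assume f: "weak_star_null f \<and> disjoint_seq f" and \<Phi>: "bounded_linear \<Phi>"
    and "\<not> (\<lambda>n. \<Phi> (f n o\<^sub>L T)) \<longlonglongrightarrow> 0"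
  then obtain \<epsilon> where \<epsilon>: "0 < \<epsilon>" "\<And>N. \<exists>n\<ge>N. \<epsilon> \<le> \<bar>\<Phi> (f n o\<^sub>L T)\<bar>"
    unfolding LIMSEQ_iff by (auto simp: not_less)
  have "infinite {n. \<epsilon> \<le> \<bar>\<Phi> (f n o\<^sub>L T)\<bar>}"
    unfolding infinite_nat_iff_unbounded_le using \<epsilon>(2) by blast
  then obtain s :: "nat \<Rightarrow> nat" where s: "strict_mono s" "\<And>n. \<epsilon> \<le> \<bar>\<Phi> (f (s n) o\<^sub>L T)\<bar>"
    using infinite_enumerate by blast
  obtain C0 where C0: "0 < C0" "\<And>n. norm (f n) \<le> C0" using weak_star_null_bounded f by blast
  \<comment> \<open>Adding 1 keeps \<open>C\<close> positive when \<open>T = 0\<close>.\<close>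
  define C where "C = C0 * (norm T + 1)"
  have C: "0 < C" using C0(1) by (simp add: C_def add_nonneg_pos)
  have fC: "norm (f n o\<^sub>L T) \<le> C" for n
  proof -
    have "norm (f n o\<^sub>L T) \<le> norm (f n) * norm T" by (rule norm_blinfun_compose)
    also have "\<dots> \<le> C" unfolding C_def using C0 by (intro mult_mono) auto
    finally show ?thesis .
  qed
  obtain K where K: "0 < K" "\<And>g. norm (\<Phi> g) \<le> norm g * K" using bounded_linear.pos_bounded[OF \<Phi>] by blast
  \<comment> \<open>Chosen so that the part of \<open>f (s n) o T\<close> off \<open>S n\<close>
    contributes at most \<open>\<eta> * K = \<epsilon> / 2\<close> to the value of
    \<open>\<Phi>\<close>.\<close>
  define \<eta> where "\<eta> = \<epsilon> / (2 * K)"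
  have \<eta>: "0 < \<eta>" using \<epsilon>(1) K(1) by (simp add: \<eta>_def)
  define S where "S n = {k. \<eta> < \<bar>f (s n) (a k)\<bar>}" for n
  have small: "norm (f (s n) o\<^sub>L T o\<^sub>L l1_restrict (- S n)) \<le> \<eta>" for n
  proof (rule norm_blinfun_bound)
    fix x
    let ?y = "l1_restrict (- S n) x"
    have sums: "(\<lambda>k. l1_apply ?y k * f (s n) (a k)) sums f (s n) (T ?y)"
      using bounded_linear.sums[OF blinfun.bounded_linear_right T[of ?y], of "f (s n)"]
      by (simp add: blinfun.scaleR_right)
    have b: "norm (l1_apply ?y k * f (s n) (a k)) \<le> \<bar>l1_apply x k\<bar> * \<eta>" for k
      using \<eta> by (auto simp: l1_apply_restrict S_def abs_mult not_less intro!: mult_left_mono)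
    have sx: "summable (\<lambda>k. \<bar>l1_apply x k\<bar>)" using l1_apply[of x] by simp
    have "norm (f (s n) (T ?y)) \<le> (\<Sum>k. \<bar>l1_apply x k\<bar> * \<eta>)"
      unfolding sums_unique[OF sums] by (rule norm_suminf_le[OF b summable_mult2[OF sx]])
    also have "\<dots> = norm x * \<eta>" using suminf_mult2[OF sx] by (simp add: norm_l1.rep_eq)
    finally show "norm ((f (s n) o\<^sub>L T o\<^sub>L l1_restrict (- S n)) x) \<le> \<eta> * norm x"
      by (simp add: mult.commute)
  qed (use \<eta> in simp)
  have "\<epsilon> / (2 * C) \<le> variation \<Phi> (S n)" for n
  proof -
    have "\<epsilon> \<le> C * variation \<Phi> (S n) + \<bar>\<Phi> (f (s n) o\<^sub>L T o\<^sub>L l1_restrict (- S n))\<bar>"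
      using functional_le_variation[OF \<Phi> C fC, of "s n" "S n"] s(2)[of n] by linarith
    also have "\<bar>\<Phi> (f (s n) o\<^sub>L T o\<^sub>L l1_restrict (- S n))\<bar> \<le> \<eta> * K"
      by (rule order_trans[OF K(2)[unfolded real_norm_def] mult_right_mono[OF small less_imp_le[OF K(1)]]])
    also have "\<eta> * K = \<epsilon> / 2" using K(1) by (simp add: \<eta>_def)
    finally show ?thesis using C by (simp add: field_simps)
  qed
  moreover have "0 < \<epsilon> / (2 * C)" using \<epsilon>(1) C by simp
  \<comment> \<open>For every \<open>j \<ge> i\<close>, \<open>k j\<close> has a large coordinate
    with index in the window \<open>{i..N i}\<close>, which is finite and does not depend on
    \<open>j\<close>.\<close>
  ultimately obtain N k where Nk: "\<And>i j. i \<le> j \<Longrightarrow> \<exists>m\<in>{i..N i}. k j \<in> S m"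
    using finitely_additive_limsup[of "variation \<Phi>" "\<epsilon> / (2 * C)" S]
      variation_mono[OF \<Phi>] variation_subadditive[OF \<Phi>] variation_superadditive[OF \<Phi>] by metis
  have rwc: "rel_weakly_compact_in c0_space (c0_op f ` A)"
    using A(1) f by (auto simp: almost_grothendieck_set_def)
  have mem: "c0_op f (a (k j)) \<in> c0_op f ` A" for j using A(2) by blast
  obtain b where b: "b \<in> c0_space"
      "\<And>U N. openin (weak_topology_on c0_space) U \<Longrightarrow> b \<in> U \<Longrightarrow> \<exists>n\<ge>N. c0_op f (a (k n)) \<in> U"
    by (rule rel_weakly_compact_in_cluster_point[OF rwc mem]) (rule that)
  have big: "\<exists>m\<ge>i. \<eta> \<le> \<bar>b (s m)\<bar>" for i
  proof (rule ccontr)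
    assume none: "\<not> (\<exists>m\<ge>i. \<eta> \<le> \<bar>b (s m)\<bar>)"
    have ne: "{i..N i} \<noteq> {}" using Nk[of i i] by auto
    \<comment> \<open>Finiteness of the window makes this a weak neighbourhood; \<open>b\<close>
      would lie in it, yet \<open>c0_op f (a (k j))\<close> avoids it for all
      \<open>j \<ge> i\<close>.\<close>
    let ?U = "\<Inter>m\<in>{i..N i}. {y\<in>c0_space. apply_bcontfun y (s m) \<in> {- \<eta><..<\<eta>}}"
    have "openin (weak_topology_on c0_space) ?U"
      by (rule openin_INT2[OF _ ne])
        (simp_all only: finite_atLeastAtMost openin_weak_topology_on[OF bounded_linear_on_coordinate open_greaterThanLessThan])
    moreover have "- \<eta> < b (s m)" "b (s m) < \<eta>" if "i \<le> m" for m
      using none that by (smt (verit))+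
    then have "b \<in> ?U" using b(1) by simp
    ultimately obtain j where j: "j \<ge> i" "c0_op f (a (k j)) \<in> ?U" using b(2) by blast
    then obtain m where "m \<in> {i..N i}" "k j \<in> S m" using Nk by blast
    then show False using j(2) f by (force simp: S_def apply_c0_op)
  qed
  have "(\<lambda>m. b (s m)) \<longlonglongrightarrow> 0"
    using b(1) LIMSEQ_subseq_LIMSEQ[OF _ s(1)] by (fastforce simp: c0_space_def comp_def)
  then obtain M where "\<And>m. m \<ge> M \<Longrightarrow> \<bar>b (s m)\<bar> < \<eta>"
    using LIMSEQ_D[OF _ \<eta>] by fastforce
  then show False using big[of M] by (meson not_le)
qed

section \<open>Boundedness of almost Grothendieck sets\<close>

lemma lmod_zero_le: "0 \<le> x \<Longrightarrow> lmod 0 \<le> (x :: 'e::banach_lattice)"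
  by (simp add: lmod_def)

lemma norm_le_of_lmod_le: "lmod y \<le> x \<Longrightarrow> norm (y :: 'e::banach_lattice) \<le> norm x"
  unfolding lmod_def by (rule lattice_norm) (rule le_supI1)

lemma dual_mod_zero_functional: "0 \<le> x \<Longrightarrow> dual_mod 0 (x :: 'e::banach_lattice) = 0"
  using lmod_zero_le[of x] unfolding dual_mod_def by (auto simp: image_constant_conv)

lemma dual_mod_zero: "dual_mod f (0 :: 'e::banach_lattice) = 0"
proof -
  have "{y :: 'e. lmod y \<le> 0} = {0}" using norm_le_of_lmod_le[of _ 0] lmod_zero_le[of 0] by auto
  then show ?thesis by (simp add: dual_mod_def blinfun.zero_right)
qed

text \<open>The bound \<open>norm f * norm x\<close> makes the supremum genuine, and
  \<open>y = 0\<close> contributes the value 0.\<close>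

lemma dual_mod_nonneg:
  assumes "0 \<le> (x :: 'e::banach_lattice)"
  shows "0 \<le> dual_mod f x"
proof -
  have "bdd_above ((\<lambda>y. \<bar>blinfun_apply f y\<bar>) ` {y. lmod y \<le> x})"
  proof (rule bdd_aboveI2)
    fix y assume "y \<in> {y. lmod y \<le> x}"
    then have "norm f * norm y \<le> norm f * norm x" by (intro mult_left_mono norm_le_of_lmod_le) auto
    then show "\<bar>f y\<bar> \<le> norm f * norm x" using norm_blinfun[of f y] by simp
  qed
  then have "\<bar>f 0\<bar> \<le> dual_mod f x"
    unfolding dual_mod_def using lmod_zero_le[OF assms] by (intro cSUP_upper) auto
  then show ?thesis by simp
qed

text \<open>The infimum is attained with value 0 at an endpoint: \<open>y = 0\<close> in the first
  case, \<open>y = x\<close> in the second.\<close>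

lemma dual_disjoint_zero:
  "dual_disjoint f (0 :: 'e::banach_lattice \<Rightarrow>\<^sub>L real)" "dual_disjoint (0 :: 'e \<Rightarrow>\<^sub>L real) f"
proof -
  show "dual_disjoint f 0"
    unfolding dual_disjoint_def
  proof (intro allI impI)
    fix x :: 'e assume x: "0 \<le> x"
    show "(INF y\<in>{y. 0 \<le> y \<and> y \<le> x}. dual_mod f y + dual_mod 0 (x - y)) = 0"
      by (rule cInf_eq_minimum)
        (use x in \<open>auto simp: dual_mod_zero_functional dual_mod_zero dual_mod_nonneg intro!: image_eqI[of _ _ 0]\<close>)
  qed
  show "dual_disjoint 0 f"
    unfolding dual_disjoint_def
  proof (intro allI impI)
    fix x :: 'e assume x: "0 \<le> x"
    show "(INF y\<in>{y. 0 \<le> y \<and> y \<le> x}. dual_mod 0 y + dual_mod f (x - y)) = 0"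
      by (rule cInf_eq_minimum)
        (use x in \<open>auto simp: dual_mod_zero_functional dual_mod_zero dual_mod_nonneg intro!: image_eqI[of _ _ x]\<close>)
  qed
qed

text \<open>Testing against \<open>g, 0, 0, ...\<close> and reading off coordinate 0 shows that
  \<open>A\<close> is weakly bounded, hence norm bounded.\<close>

lemma almost_grothendieck_set_bounded:
  fixes A :: "'e::banach_lattice set"
  assumes "almost_grothendieck_set A"
  obtains C where "0 < C" "\<And>a. a \<in> A \<Longrightarrow> norm a \<le> C"
proof -
  have "bounded (blinfun_apply g ` A)" for g :: "'e \<Rightarrow>\<^sub>L real"
  proof -
    define f where "f = (\<lambda>n::nat. if n = 0 then g else 0)"
    have w: "weak_star_null f"
      unfolding weak_star_null_def f_def
      by (intro allI tendsto_eventually) (auto simp: eventually_sequentially intro!: exI[of _ 1])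
    moreover have "disjoint_seq f" by (auto simp: disjoint_seq_def f_def dual_disjoint_zero)
    ultimately have "rel_weakly_compact_in c0_space (c0_op f ` A)"
      using assms by (auto simp: almost_grothendieck_set_def)
    then have "bounded ((\<lambda>y. apply_bcontfun y 0) ` c0_op f ` A)"
      by (rule rel_weakly_compact_in_bounded_image) (rule bounded_linear_on_coordinate)
    moreover have "apply_bcontfun (c0_op f a) 0 = g a" for a
      unfolding apply_c0_op[OF w] by (simp add: f_def)
    ultimately show ?thesis by (simp add: image_image)
  qed
  then show thesis using weakly_bounded_imp_bounded that by blast
qed

section \<open>The characterisation\<close>

text \<open>A formula cannot quantify over types, so (2) is stated for an arbitrary Banach type
  \<open>'x\<close>, as a consequence of (1), next to the equivalence of (1) and (3).\<close>

theorem mainTheorem4: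
  shows "((\<forall>A :: 'e::banach_lattice set. almost_grothendieck_set A \<longrightarrow> rel_weakly_compact_in UNIV A)
           \<longleftrightarrow> (\<forall>T :: l1 \<Rightarrow>\<^sub>L 'e. almost_grothendieck_op T \<longrightarrow> weakly_compact_op T))
       \<and> ((\<forall>A :: 'e set. almost_grothendieck_set A \<longrightarrow> rel_weakly_compact_in UNIV A)
           \<longrightarrow> (\<forall>T :: 'x::banach \<Rightarrow>\<^sub>L 'e. almost_grothendieck_op T \<longrightarrow> weakly_compact_op T))"
proof (intro conjI iffI impI allI)
  fix T :: "l1 \<Rightarrow>\<^sub>L 'e"
  assume "\<forall>A :: 'e set. almost_grothendieck_set A \<longrightarrow> rel_weakly_compact_in UNIV A" "almost_grothendieck_op T"
  then show "weakly_compact_op T"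
    unfolding weakly_compact_op_def using almost_grothendieck_op_image_ball by blast
next
  fix T :: "'x \<Rightarrow>\<^sub>L 'e"
  assume "\<forall>A :: 'e set. almost_grothendieck_set A \<longrightarrow> rel_weakly_compact_in UNIV A" "almost_grothendieck_op T"
  then show "weakly_compact_op T"
    unfolding weakly_compact_op_def using almost_grothendieck_op_image_ball by blast
next
  fix A :: "'e set"
  assume op: "\<forall>T :: l1 \<Rightarrow>\<^sub>L 'e. almost_grothendieck_op T \<longrightarrow> weakly_compact_op T"
    and A: "almost_grothendieck_set A"
  show "rel_weakly_compact_in UNIV A"
  proof (rule ccontr)
    assume not: "\<not> rel_weakly_compact_in UNIV A"
    obtain C where C: "\<And>a. a \<in> A \<Longrightarrow> norm a \<le> C" using almost_grothendieck_set_bounded[OF A] by blast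
    obtain x :: "nat \<Rightarrow> 'e" and f :: "nat \<Rightarrow> 'e \<Rightarrow>\<^sub>L real" and \<theta> where \<theta>: "0 < \<theta>" and xA: "\<And>n. x n \<in> A"
      and f: "\<And>n. norm (f n) \<le> 1" "\<And>k n. k \<le> n \<Longrightarrow> \<theta> < blinfun_apply (f k) (x n)"
        "\<And>k n. n < k \<Longrightarrow> blinfun_apply (f k) (x n) = 0"
      by (rule not_rel_weakly_compact_imp_James_sequence[where A = A and C = C])
        (rule C, assumption, rule not, rule that)
    obtain T :: "l1 \<Rightarrow>\<^sub>L 'e" where T: "\<And>y. (\<lambda>k. l1_apply y k *\<^sub>R x k) sums T y"
      using ex_l1_combination[of x C] C xA by blast
    have "weakly_compact_op T" using op almost_grothendieck_set_imp_op[OF A xA T] by blast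
    \<comment> \<open>The \<open>x n\<close> are the images of the unit vectors, so weak compactness
      of \<open>T\<close> would pass to them.\<close>
    moreover have "range x \<subseteq> blinfun_apply T ` cball 0 1"
    proof (clarify, rule image_eqI)
      fix n
      have "(\<lambda>k. l1_apply (l1_unit n) k *\<^sub>R x k) sums (\<Sum>k\<in>{n}. l1_apply (l1_unit n) k *\<^sub>R x k)"
        by (rule sums_finite) (auto simp: l1_unit.rep_eq)
      then show "x n = T (l1_unit n)"
        using sums_unique2[OF T] by (fastforce simp: l1_unit.rep_eq)
      show "l1_unit n \<in> cball 0 1" by (simp add: norm_l1_unit)
    qed
    ultimately have "rel_weakly_compact_in UNIV (range x)"
      unfolding weakly_compact_op_def by (rule rel_weakly_compact_in_mono)
    then show False using James_sequence_not_rel_weakly_compact[OF \<theta>, of f x] f by blast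
  qed
qed

end
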